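(* Let $\mathcal A$ be a locally small abelian category with enough projectives. Suppose that $\mathcal A$ is Krull--Schmidt and that $\mathcal T^n(\mathcal A)$ has only finitely many isomorphism classes of indecomposable objects for some $n\ge1$. Then $\mathcal A$ is weakly Gorenstein.
   Context: $\mathcal A$ is Krull--Schmidt if each object is a finite direct sum of indecomposables with local endomorphism rings. $\mathcal P(\mathcal A)$ is the full subcategory of projectives and ${}^{\perp}\mathcal P(\mathcal A)=\{X\in\mathcal A\mid \mathrm{Ext}^i_{\mathcal A}(X,P)=0\text{ for all }i\ge1,\ P\in\mathcal P(\mathcal A)\}$. A morphism $f:M\to P$ with $P$ projective is a left projective approximation if every morphism from $M$ to a projective object factors through $f$. For $n\ge1$, $M$ is $n$-torsionfree if there is an exact sequence $0\to M\xrightarrow{f_1}P_1\xrightarrow{f_2}\cdots\xrightarrow{f_n}P_n$ with all $P_i$ projective such that each inclusion $\mathrm{Im} f_i\to P_i$ is a left projective approximation ($1\le i\le n$); $\mathcal T^n(\mathcal A)$ is the full subcategory of such objects. An object is Gorenstein projective if it is isomorphic to the zeroth cocycle of a totally acyclic complex, i.e. of an acyclic complex of projectives, unbounded in both directions, that remains acyclic after applying $\mathrm{Hom}_{\mathcal A}(-,P)$ for every projective $P$; $\mathrm{GP}(\mathcal A)$ is the full subcategory of these objects. $\mathcal A$ is weakly Gorenstein if $\mathrm{GP}(\mathcal A)={}^{\perp}\mathcal P(\mathcal A)$. *)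

theory Defs
  imports "HOL-Algebra.Elementary_Groups" "HOL-Algebra.Ring"
begin

text \<open>
  Every arrow carries its domain and codomain, so hom-sets are disjoint. Hom-sets are sets over
  the type of arrows, which is how local smallness is built in; the type of objects is arbitrary.
\<close>

record ('o, 'm) cat =
  Ob :: "'o set"
  Arr :: "'m set"
  Dom :: "'m \<Rightarrow> 'o"
  Cod :: "'m \<Rightarrow> 'o"
  Ide :: "'o \<Rightarrow> 'm"
  Comp :: "'m \<Rightarrow> 'm \<Rightarrow> 'm" (infixr "\<cdot>\<index>" 70)
  Add :: "'m \<Rightarrow> 'm \<Rightarrow> 'm"
  Zero :: "'o \<Rightarrow> 'o \<Rightarrow> 'm"

definition Hom :: "('o, 'm, 'z) cat_scheme \<Rightarrow> 'o \<Rightarrow> 'o \<Rightarrow> 'm set" where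
  "Hom C X Y = {f \<in> Arr C. Dom C f = X \<and> Cod C f = Y}"

definition hom_group :: "('o, 'm, 'z) cat_scheme \<Rightarrow> 'o \<Rightarrow> 'o \<Rightarrow> 'm monoid" where
  "hom_group C X Y = \<lparr>carrier = Hom C X Y, mult = Add C, one = Zero C X Y\<rparr>"

definition end_ring :: "('o, 'm, 'z) cat_scheme \<Rightarrow> 'o \<Rightarrow> 'm ring" where
  "end_ring C X = \<lparr>carrier = Hom C X X, mult = Comp C, one = Ide C X,
                   zero = Zero C X X, add = Add C\<rparr>"


subsection \<open>Abelian categories\<close>

locale category =
  fixes C :: "('o, 'm, 'z) cat_scheme" (structure)
  assumes Dom_Ob: "f \<in> Arr C \<Longrightarrow> Dom C f \<in> Ob C"
    and Cod_Ob: "f \<in> Arr C \<Longrightarrow> Cod C f \<in> Ob C"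
    and Ide_Hom: "X \<in> Ob C \<Longrightarrow> Ide C X \<in> Hom C X X"
    and Comp_Hom: "\<lbrakk>f \<in> Hom C X Y; g \<in> Hom C Y Z\<rbrakk> \<Longrightarrow> g \<cdot> f \<in> Hom C X Z"
    and Comp_Ide: "f \<in> Hom C X Y \<Longrightarrow> f \<cdot> Ide C X = f"
    and Ide_Comp: "f \<in> Hom C X Y \<Longrightarrow> Ide C Y \<cdot> f = f"
    and Comp_assoc: "\<lbrakk>f \<in> Hom C W X; g \<in> Hom C X Y; h \<in> Hom C Y Z\<rbrakk>
          \<Longrightarrow> (h \<cdot> g) \<cdot> f = h \<cdot> (g \<cdot> f)"

locale preadditive_category = category +
  assumes hom_group: "\<lbrakk>X \<in> Ob C; Y \<in> Ob C\<rbrakk> \<Longrightarrow> comm_group (hom_group C X Y)"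
    and Comp_Add: "\<lbrakk>f \<in> Hom C X Y; f' \<in> Hom C X Y; g \<in> Hom C Y Z\<rbrakk>
          \<Longrightarrow> g \<cdot> Add C f f' = Add C (g \<cdot> f) (g \<cdot> f')"
    and Add_Comp: "\<lbrakk>f \<in> Hom C X Y; g \<in> Hom C Y Z; g' \<in> Hom C Y Z\<rbrakk>
          \<Longrightarrow> Add C g g' \<cdot> f = Add C (g \<cdot> f) (g' \<cdot> f)"

text \<open>
  \<open>X\<close> is the direct sum (biproduct) of \<open>Y 0, \<dots>, Y (n - 1)\<close>. The product in \<open>hom_group\<close> is the
  sum of the morphisms \<open>\<iota> i \<cdot> \<pi> i\<close>. For \<open>n = 0\<close> this says that \<open>X\<close> is a zero object.
\<close>

definition is_direct_sum ::
  "('o, 'm, 'z) cat_scheme \<Rightarrow> nat \<Rightarrow> (nat \<Rightarrow> 'o) \<Rightarrow> 'o \<Rightarrow> (nat \<Rightarrow> 'm) \<Rightarrow> (nat \<Rightarrow> 'm) \<Rightarrow> bool" where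
  "is_direct_sum C n Y X \<iota> \<pi> \<longleftrightarrow>
     X \<in> Ob C \<and> (\<forall>i<n. Y i \<in> Ob C \<and> \<iota> i \<in> Hom C (Y i) X \<and> \<pi> i \<in> Hom C X (Y i)) \<and>
     (\<forall>i<n. \<forall>j<n. \<pi> i \<cdot>\<^bsub>C\<^esub> \<iota> j = (if i = j then Ide C (Y i) else Zero C (Y j) (Y i))) \<and>
     finprod (hom_group C X X) (\<lambda>i. \<iota> i \<cdot>\<^bsub>C\<^esub> \<pi> i) {..<n} = Ide C X"

locale additive_category = preadditive_category +
  assumes direct_sums:
    "(\<And>i. i < n \<Longrightarrow> Y i \<in> Ob C) \<Longrightarrow> \<exists>X \<iota> \<pi>. is_direct_sum C n Y X \<iota> \<pi>"

definition mono_arr :: "('o, 'm, 'z) cat_scheme \<Rightarrow> 'm \<Rightarrow> bool" where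
  "mono_arr C f \<longleftrightarrow> f \<in> Arr C \<and>
     (\<forall>Z. \<forall>g \<in> Hom C Z (Dom C f). \<forall>h \<in> Hom C Z (Dom C f). f \<cdot>\<^bsub>C\<^esub> g = f \<cdot>\<^bsub>C\<^esub> h \<longrightarrow> g = h)"

definition epi_arr :: "('o, 'm, 'z) cat_scheme \<Rightarrow> 'm \<Rightarrow> bool" where
  "epi_arr C f \<longleftrightarrow> f \<in> Arr C \<and>
     (\<forall>Z. \<forall>g \<in> Hom C (Cod C f) Z. \<forall>h \<in> Hom C (Cod C f) Z. g \<cdot>\<^bsub>C\<^esub> f = h \<cdot>\<^bsub>C\<^esub> f \<longrightarrow> g = h)"

definition is_kernel :: "('o, 'm, 'z) cat_scheme \<Rightarrow> 'm \<Rightarrow> 'm \<Rightarrow> bool" where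
  "is_kernel C f k \<longleftrightarrow> f \<in> Arr C \<and> k \<in> Arr C \<and> Cod C k = Dom C f \<and>
     f \<cdot>\<^bsub>C\<^esub> k = Zero C (Dom C k) (Cod C f) \<and>
     (\<forall>Z. \<forall>g \<in> Hom C Z (Dom C f). f \<cdot>\<^bsub>C\<^esub> g = Zero C Z (Cod C f) \<longrightarrow>
        (\<exists>!h. h \<in> Hom C Z (Dom C k) \<and> k \<cdot>\<^bsub>C\<^esub> h = g))"

definition is_cokernel :: "('o, 'm, 'z) cat_scheme \<Rightarrow> 'm \<Rightarrow> 'm \<Rightarrow> bool" where
  "is_cokernel C f c \<longleftrightarrow> f \<in> Arr C \<and> c \<in> Arr C \<and> Dom C c = Cod C f \<and>
     c \<cdot>\<^bsub>C\<^esub> f = Zero C (Dom C f) (Cod C c) \<and>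
     (\<forall>Z. \<forall>g \<in> Hom C (Cod C f) Z. g \<cdot>\<^bsub>C\<^esub> f = Zero C (Dom C f) Z \<longrightarrow>
        (\<exists>!h. h \<in> Hom C (Cod C c) Z \<and> h \<cdot>\<^bsub>C\<^esub> c = g))"

locale abelian_category = additive_category +
  assumes kernels: "f \<in> Arr C \<Longrightarrow> \<exists>k. is_kernel C f k"
    and cokernels: "f \<in> Arr C \<Longrightarrow> \<exists>c. is_cokernel C f c"
    and mono_is_kernel: "mono_arr C f \<Longrightarrow> \<exists>g. is_kernel C g f"
    and epi_is_cokernel: "epi_arr C f \<Longrightarrow> \<exists>g. is_cokernel C g f"

text \<open>The image of \<open>f\<close>, as a subobject \<open>m\<close> of the codomain, is the kernel of the cokernel;
  exactness at the middle object says that the image of \<open>f\<close> is a kernel of \<open>g\<close>.\<close>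

definition is_image :: "('o, 'm, 'z) cat_scheme \<Rightarrow> 'm \<Rightarrow> 'm \<Rightarrow> bool" where
  "is_image C f m \<longleftrightarrow> (\<exists>c. is_cokernel C f c \<and> is_kernel C c m)"

definition exact_at :: "('o, 'm, 'z) cat_scheme \<Rightarrow> 'm \<Rightarrow> 'm \<Rightarrow> bool" where
  "exact_at C f g \<longleftrightarrow> (\<exists>m. is_image C f m \<and> is_kernel C g m)"

definition iso_rel :: "('o, 'm, 'z) cat_scheme \<Rightarrow> ('o \<times> 'o) set" where
  "iso_rel C = {(X, Y). X \<in> Ob C \<and> Y \<in> Ob C \<and>
     (\<exists>f \<in> Hom C X Y. \<exists>g \<in> Hom C Y X. g \<cdot>\<^bsub>C\<^esub> f = Ide C X \<and> f \<cdot>\<^bsub>C\<^esub> g = Ide C Y)}"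


subsection \<open>Krull--Schmidt categories\<close>

definition is_zero_obj :: "('o, 'm, 'z) cat_scheme \<Rightarrow> 'o \<Rightarrow> bool" where
  "is_zero_obj C X \<longleftrightarrow> X \<in> Ob C \<and>
     (\<forall>Y \<in> Ob C. (\<exists>!f. f \<in> Hom C X Y) \<and> (\<exists>!f. f \<in> Hom C Y X))"

definition indecomposable :: "('o, 'm, 'z) cat_scheme \<Rightarrow> 'o \<Rightarrow> bool" where
  "indecomposable C X \<longleftrightarrow> X \<in> Ob C \<and> \<not> is_zero_obj C X \<and>
     (\<forall>Y \<iota> \<pi>. is_direct_sum C 2 Y X \<iota> \<pi> \<longrightarrow> is_zero_obj C (Y 0) \<or> is_zero_obj C (Y 1))"

text \<open>Not necessarily commutative local rings: nonzero, and sums of non-units are non-units.\<close>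

definition local_ring :: "('a, 'z) ring_scheme \<Rightarrow> bool" where
  "local_ring R \<longleftrightarrow> ring R \<and> \<one>\<^bsub>R\<^esub> \<noteq> \<zero>\<^bsub>R\<^esub> \<and>
     (\<forall>a \<in> carrier R - Units R. \<forall>b \<in> carrier R - Units R. a \<oplus>\<^bsub>R\<^esub> b \<notin> Units R)"

definition krull_schmidt :: "('o, 'm, 'z) cat_scheme \<Rightarrow> bool" where
  "krull_schmidt C \<longleftrightarrow> (\<forall>X \<in> Ob C. \<exists>n Y \<iota> \<pi>. is_direct_sum C n Y X \<iota> \<pi> \<and>
     (\<forall>i<n. indecomposable C (Y i) \<and> local_ring (end_ring C (Y i))))"


subsection \<open>Projective objects and Ext\<close>

definition projective :: "('o, 'm, 'z) cat_scheme \<Rightarrow> 'o \<Rightarrow> bool" where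
  "projective C P \<longleftrightarrow> P \<in> Ob C \<and>
     (\<forall>X Y. \<forall>g \<in> Hom C X Y. epi_arr C g \<longrightarrow>
        (\<forall>f \<in> Hom C P Y. \<exists>h \<in> Hom C P X. g \<cdot>\<^bsub>C\<^esub> h = f))"

definition enough_projectives :: "('o, 'm, 'z) cat_scheme \<Rightarrow> bool" where
  "enough_projectives C \<longleftrightarrow>
     (\<forall>X \<in> Ob C. \<exists>P. projective C P \<and> (\<exists>p \<in> Hom C P X. epi_arr C p))"

definition proj_resolution ::
  "('o, 'm, 'z) cat_scheme \<Rightarrow> 'o \<Rightarrow> (nat \<Rightarrow> 'o) \<times> (nat \<Rightarrow> 'm) \<times> 'm \<Rightarrow> bool" where
  "proj_resolution C X = (\<lambda>(P, d, e).
     (\<forall>i. projective C (P i) \<and> d i \<in> Hom C (P (Suc i)) (P i)) \<and>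
     e \<in> Hom C (P 0) X \<and> epi_arr C e \<and>
     exact_at C (d 0) e \<and> (\<forall>i. exact_at C (d (Suc i)) (d i)))"

definition hom_cocycles ::
  "('o, 'm, 'z) cat_scheme \<Rightarrow> (nat \<Rightarrow> 'o) \<Rightarrow> (nat \<Rightarrow> 'm) \<Rightarrow> 'o \<Rightarrow> nat \<Rightarrow> 'm set" where
  "hom_cocycles C P d Y i =
     kernel (hom_group C (P i) Y) (hom_group C (P (Suc i)) Y) (\<lambda>f. f \<cdot>\<^bsub>C\<^esub> d i)"

definition hom_coboundaries ::
  "('o, 'm, 'z) cat_scheme \<Rightarrow> (nat \<Rightarrow> 'o) \<Rightarrow> (nat \<Rightarrow> 'm) \<Rightarrow> 'o \<Rightarrow> nat \<Rightarrow> 'm set" where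
  "hom_coboundaries C P d Y i =
     (case i of 0 \<Rightarrow> {Zero C (P 0) Y} | Suc j \<Rightarrow> (\<lambda>f. f \<cdot>\<^bsub>C\<^esub> d j) ` Hom C (P j) Y)"

text \<open>
  \<open>Ext C i X Y\<close> is the \<open>i\<close>-th cohomology group of \<open>Hom(P, Y)\<close> for a chosen projective resolution
  \<open>P\<close> of \<open>X\<close>; it is meaningful when there are enough projectives.
\<close>

definition Ext :: "('o, 'm, 'z) cat_scheme \<Rightarrow> nat \<Rightarrow> 'o \<Rightarrow> 'o \<Rightarrow> 'm set monoid" where
  "Ext C i X Y = (case SOME r. proj_resolution C X r of (P, d, e) \<Rightarrow>
     (hom_group C (P i) Y)\<lparr>carrier := hom_cocycles C P d Y i\<rparr> Mod hom_coboundaries C P d Y i)"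

definition perp_projectives :: "('o, 'm, 'z) cat_scheme \<Rightarrow> 'o set" where
  "perp_projectives C =
     {X \<in> Ob C. \<forall>i\<ge>1. \<forall>P. projective C P \<longrightarrow> trivial_group (Ext C i X P)}"


subsection \<open>Torsionfree and Gorenstein projective objects\<close>

definition left_proj_approx :: "('o, 'm, 'z) cat_scheme \<Rightarrow> 'm \<Rightarrow> bool" where
  "left_proj_approx C f \<longleftrightarrow> f \<in> Arr C \<and> projective C (Cod C f) \<and>
     (\<forall>Q. projective C Q \<longrightarrow>
        (\<forall>g \<in> Hom C (Dom C f) Q. \<exists>h \<in> Hom C (Cod C f) Q. h \<cdot>\<^bsub>C\<^esub> f = g))"

text \<open>The object \<open>M\<close> of the sequence \<open>0 \<rightarrow> M \<rightarrow> P 1 \<rightarrow> \<dots> \<rightarrow> P n\<close> is stored as \<open>P 0\<close>.\<close>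

definition torsionfree :: "('o, 'm, 'z) cat_scheme \<Rightarrow> nat \<Rightarrow> 'o set" where
  "torsionfree C n = {M \<in> Ob C. \<exists>P f. P 0 = M \<and>
     (\<forall>i \<in> {1..n}. projective C (P i) \<and> f i \<in> Hom C (P (i - 1)) (P i)) \<and>
     mono_arr C (f 1) \<and> (\<forall>i \<in> {1..<n}. exact_at C (f i) (f (i + 1))) \<and>
     (\<forall>i \<in> {1..n}. \<forall>m. is_image C (f i) m \<longrightarrow> left_proj_approx C m)}"

definition totally_acyclic :: "('o, 'm, 'z) cat_scheme \<Rightarrow> (int \<Rightarrow> 'o) \<Rightarrow> (int \<Rightarrow> 'm) \<Rightarrow> bool" where
  "totally_acyclic C P d \<longleftrightarrow>
     (\<forall>i. projective C (P i) \<and> d i \<in> Hom C (P i) (P (i + 1))) \<and>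
     (\<forall>i. exact_at C (d i) (d (i + 1))) \<and>
     (\<forall>Q. projective C Q \<longrightarrow> (\<forall>i.
        (\<lambda>f. f \<cdot>\<^bsub>C\<^esub> d (i + 1)) ` Hom C (P (i + 2)) Q =
        kernel (hom_group C (P (i + 1)) Q) (hom_group C (P i) Q) (\<lambda>f. f \<cdot>\<^bsub>C\<^esub> d i)))"

definition gorenstein_projectives :: "('o, 'm, 'z) cat_scheme \<Rightarrow> 'o set" where
  "gorenstein_projectives C =
     {X. \<exists>P d k. totally_acyclic C P d \<and> is_kernel C (d 0) k \<and> (X, Dom C k) \<in> iso_rel C}"

definition weakly_gorenstein :: "('o, 'm, 'z) cat_scheme \<Rightarrow> bool" where
  "weakly_gorenstein C \<longleftrightarrow> gorenstein_projectives C = perp_projectives C"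

end

theory Submission
  imports Defs
begin

text \<open>
  Modulo morphisms that factor through projectives, taking syzygies is fully faithful on
  \<open>\<^sup>\<bottom>P\<close>. If \<open>M\<close> in \<open>\<^sup>\<bottom>P\<close> is nonprojective with local endomorphism ring, its syzygy therefore has a
  unique nonprojective indecomposable summand, which again lies in \<open>\<^sup>\<bottom>P\<close>. Iterating gives a sequence
  \<open>M = N 0, N 1, \<dots>\<close> with \<open>N i\<close> in \<open>T\<^sup>i\<close>, so two of its terms with index at least \<open>n\<close> are isomorphic.
  By faithfulness \<open>M\<close> is then stably a retract of some \<open>N k\<close> with \<open>k \<ge> 1\<close>. Hence \<open>M\<close>, and so every object of
  \<open>\<^sup>\<bottom>P\<close>, embeds into a projective by a left approximation; the cokernel is again in \<open>\<^sup>\<bottom>P\<close>, and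
  splicing such embeddings with a projective resolution gives a totally acyclic complex.
\<close>

text \<open>The stable category is never built. The relation \<open>stable_retract\<close> records a
  splitting up to a map through a projective, and this weak form of stable isomorphism is enough:
  projectivity, membership in \<open>\<^sup>\<bottom>P\<close> and the existence of coresolutions
  all pass to stable retracts.

  The left half of a complete resolution comes with membership in \<open>\<^sup>\<bottom>P\<close>;
  the obstacle is the right half. It cannot be built directly, but a syzygy of an object of
  \<open>\<^sup>\<bottom>P\<close> embeds into a projective by a left approximation. Hence
  \<open>N i\<close> has a coresolution with \<open>i\<close> steps, running back to
  \<open>M\<close>, while \<open>M\<close> has none to start with. A repetition among the
  \<open>N i\<close> moves such a step to \<open>M\<close>: maps into projectives extend along left
  approximations, so projective middle terms behave like injectives and the passage to syzygies can
  be undone. Undoing it \<open>i\<close> times on both sides of an isomorphism between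
  \<open>N i\<close> and \<open>N j\<close> preserves the gap \<open>j - i\<close>, which is
  positive.\<close>

section \<open>Preadditive categories\<close>

context category
begin

lemma in_Hom: "f \<in> Hom C X Y \<longleftrightarrow> f \<in> Arr C \<and> Dom C f = X \<and> Cod C f = Y"
  by (simp add: Hom_def)

lemma Dom_in_Ob [simp]: "f \<in> Arr C \<Longrightarrow> Dom C f \<in> Ob C"
  and Cod_in_Ob [simp]: "f \<in> Arr C \<Longrightarrow> Cod C f \<in> Ob C"
  by (rule Dom_Ob Cod_Ob; assumption)+

lemma Ide_simps [simp]:
  assumes "X \<in> Ob C"
  shows "Ide C X \<in> Arr C" "Dom C (Ide C X) = X" "Cod C (Ide C X) = X"
  using Ide_Hom[OF assms] by (simp_all add: in_Hom)

text \<open>In \<open>Comp_Hom\<close> the middle object occurs only in the premises, so the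
  simplifier would have to guess it. With equations between \<open>Dom\<close> and
  \<open>Cod\<close> all side conditions are computed from the arrows; hence \<open>in_Hom\<close>
  is unfolded throughout.\<close>

lemma Comp_simps [simp]:
  assumes "f \<in> Arr C" "g \<in> Arr C" "Dom C g = Cod C f"
  shows "g \<cdot> f \<in> Arr C" "Dom C (g \<cdot> f) = Dom C f" "Cod C (g \<cdot> f) = Cod C g"
  using Comp_Hom[of f "Dom C f" "Cod C f" g "Cod C g"] assms by (simp_all add: in_Hom)

lemma assoc [simp]:
  assumes "f \<in> Arr C" "g \<in> Arr C" "h \<in> Arr C" "Dom C g = Cod C f" "Dom C h = Cod C g"
  shows "(h \<cdot> g) \<cdot> f = h \<cdot> (g \<cdot> f)"
  using Comp_assoc[of f "Dom C f" "Cod C f" g "Cod C g" h "Cod C h"] assms by (simp add: in_Hom)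

text \<open>The rule \<open>assoc\<close> nests composites to the right, where the left side of a
  known equation \<open>h \<cdot> g = e\<close> is no longer a subterm. This is the form in which
  such an equation is applied.\<close>

lemma pre_comp:
  assumes "h \<cdot> g = e" "f \<in> Arr C" "g \<in> Arr C" "h \<in> Arr C" "Dom C g = Cod C f" "Dom C h = Cod C g"
  shows "h \<cdot> (g \<cdot> f) = e \<cdot> f"
  using assms assoc[of f g h] by simp

lemma Comp_Ide_simp [simp]: "f \<in> Arr C \<Longrightarrow> Dom C f = X \<Longrightarrow> f \<cdot> Ide C X = f"
  and Ide_Comp_simp [simp]: "f \<in> Arr C \<Longrightarrow> Cod C f = X \<Longrightarrow> Ide C X \<cdot> f = f"
  by (rule Comp_Ide Ide_Comp, simp add: in_Hom)+

lemma mono_arr_cancel: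
  assumes "mono_arr C m" "m \<cdot> f = m \<cdot> g" "f \<in> Arr C" "g \<in> Arr C"
    "Cod C f = Dom C m" "Cod C g = Dom C m" "Dom C f = Dom C g"
  shows "f = g"
  using assms unfolding mono_arr_def by (auto simp: in_Hom)

lemma epi_arr_cancel:
  assumes "epi_arr C e" "f \<cdot> e = g \<cdot> e" "f \<in> Arr C" "g \<in> Arr C"
    "Dom C f = Cod C e" "Dom C g = Cod C e" "Cod C f = Cod C g"
  shows "f = g"
  using assms unfolding epi_arr_def by (auto simp: in_Hom)

lemma mono_arr_Comp:
  assumes "mono_arr C f" "mono_arr C g" "Dom C g = Cod C f"
  shows "mono_arr C (g \<cdot> f)"
proof -
  have a: "f \<in> Arr C" "g \<in> Arr C" using assms by (auto simp: mono_arr_def)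
  show ?thesis
    unfolding mono_arr_def
  proof (intro conjI allI ballI impI)
    fix Z x y assume "x \<in> Hom C Z (Dom C (g \<cdot> f))" "y \<in> Hom C Z (Dom C (g \<cdot> f))"
      and e: "(g \<cdot> f) \<cdot> x = (g \<cdot> f) \<cdot> y"
    then have x: "x \<in> Arr C" "Dom C x = Z" "Cod C x = Dom C f"
      and y: "y \<in> Arr C" "Dom C y = Z" "Cod C y = Dom C f" using a assms by (auto simp: in_Hom)
    have "g \<cdot> (f \<cdot> x) = g \<cdot> (f \<cdot> y)" using e a assms x y by simp
    then have "f \<cdot> x = f \<cdot> y"
      by (rule mono_arr_cancel[OF assms(2)]) (use a assms x y in auto)
    then show "x = y" by (rule mono_arr_cancel[OF assms(1)]) (use a assms x y in auto)
  qed (use a assms in simp)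
qed

end

context preadditive_category
begin

lemma hom_group_simps [simp]:
  "carrier (hom_group C X Y) = Hom C X Y" "mult (hom_group C X Y) = Add C"
  "one (hom_group C X Y) = Zero C X Y"
  by (simp_all add: hom_group_def)

lemma Zero_simps [simp]:
  assumes "X \<in> Ob C" "Y \<in> Ob C"
  shows "Zero C X Y \<in> Arr C" "Dom C (Zero C X Y) = X" "Cod C (Zero C X Y) = Y"
proof -
  interpret H: comm_group "hom_group C X Y" by (rule hom_group[OF assms])
  show "Zero C X Y \<in> Arr C" "Dom C (Zero C X Y) = X" "Cod C (Zero C X Y) = Y"
    using H.one_closed by (simp_all add: in_Hom)
qed

lemma Add_simps [simp]:
  assumes "f \<in> Arr C" "g \<in> Arr C" "Dom C f = Dom C g" "Cod C f = Cod C g"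
  shows "Add C f g \<in> Arr C" "Dom C (Add C f g) = Dom C g" "Cod C (Add C f g) = Cod C g"
proof -
  interpret H: comm_group "hom_group C (Dom C g) (Cod C g)" by (rule hom_group) (use assms in auto)
  show "Add C f g \<in> Arr C" "Dom C (Add C f g) = Dom C g" "Cod C (Add C f g) = Cod C g"
    using H.m_closed[of f g] assms by (simp_all add: in_Hom)
qed

lemma Add_assoc:
  assumes "f \<in> Arr C" "g \<in> Arr C" "h \<in> Arr C" "Dom C f = Dom C g" "Cod C f = Cod C g"
    "Dom C h = Dom C g" "Cod C h = Cod C g"
  shows "Add C (Add C f g) h = Add C f (Add C g h)"
proof -
  interpret H: comm_group "hom_group C (Dom C g) (Cod C g)" by (rule hom_group) (use assms in auto)
  show ?thesis using H.m_assoc[of f g h] assms by (simp add: in_Hom)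
qed

lemma Add_Zero [simp]:
  assumes "f \<in> Arr C" "Dom C f = X" "Cod C f = Y"
  shows "Add C f (Zero C X Y) = f" "Add C (Zero C X Y) f = f"
proof -
  interpret H: comm_group "hom_group C X Y" by (rule hom_group) (use assms in auto)
  show "Add C f (Zero C X Y) = f" "Add C (Zero C X Y) f = f"
    using H.r_one[of f] H.l_one[of f] assms by (simp_all add: in_Hom)
qed

text \<open>The record \<open>cat\<close> has no subtraction; \<open>d\<close> stands in for
  \<open>f - g\<close>.\<close>

lemma ex_difference:
  assumes "f \<in> Hom C X Y" "g \<in> Hom C X Y"
  obtains d where "d \<in> Hom C X Y" "f = Add C g d"
proof -
  interpret H: comm_group "hom_group C X Y" by (rule hom_group) (use assms in \<open>auto simp: in_Hom\<close>)
  let ?h = "inv\<^bsub>hom_group C X Y\<^esub> g"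
  have h: "?h \<in> Hom C X Y" using H.inv_closed assms by simp
  have "Add C g (Add C ?h f) = Add C (Add C g ?h) f"
    using H.m_assoc[of g ?h f] h assms by simp
  also have "\<dots> = f" using H.r_inv[of g] H.l_one[of f] assms by simp
  finally have "f = Add C g (Add C ?h f)" by simp
  then show ?thesis using that[of "Add C ?h f"] H.m_closed[of ?h f] h assms by simp
qed

lemma Add_left_cancel:
  assumes "Add C g d = g" "g \<in> Hom C X Y" "d \<in> Hom C X Y"
  shows "d = Zero C X Y"
proof -
  interpret H: comm_group "hom_group C X Y" by (rule hom_group) (use assms in \<open>auto simp: in_Hom\<close>)
  have "g \<otimes>\<^bsub>hom_group C X Y\<^esub> d = g" using assms by simp
  then have "d = \<one>\<^bsub>hom_group C X Y\<^esub>" using H.l_cancel_one[of g d] assms by simp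
  then show ?thesis by simp
qed

lemma Comp_Add_simp [simp]:
  assumes "f \<in> Arr C" "f' \<in> Arr C" "g \<in> Arr C" "Dom C f = Dom C f'" "Cod C f = Cod C f'" "Dom C g = Cod C f'"
  shows "g \<cdot> Add C f f' = Add C (g \<cdot> f) (g \<cdot> f')"
  using Comp_Add[of f "Dom C f" "Cod C f" f' g "Cod C g"] assms by (simp add: in_Hom)

lemma Add_Comp_simp [simp]:
  assumes "f \<in> Arr C" "g \<in> Arr C" "g' \<in> Arr C" "Dom C g = Dom C g'" "Cod C g = Cod C g'" "Dom C g' = Cod C f"
  shows "Add C g g' \<cdot> f = Add C (g \<cdot> f) (g' \<cdot> f)"
  using Add_Comp[of f "Dom C f" "Cod C f" g "Cod C g" g'] assms by (simp add: in_Hom)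

lemma Comp_Zero [simp]:
  assumes "g \<in> Arr C" "Dom C g = Y" "X \<in> Ob C"
  shows "g \<cdot> Zero C X Y = Zero C X (Cod C g)"
proof -
  have Y: "Y \<in> Ob C" using assms by auto
  have "Add C (g \<cdot> Zero C X Y) (g \<cdot> Zero C X Y) = g \<cdot> Add C (Zero C X Y) (Zero C X Y)"
    using assms Y by (subst Comp_Add_simp) auto
  also have "\<dots> = g \<cdot> Zero C X Y" using assms Y by simp
  finally show ?thesis
    by (rule Add_left_cancel) (use assms Y in \<open>auto simp: in_Hom\<close>)
qed

lemma Zero_Comp [simp]:
  assumes "f \<in> Arr C" "Cod C f = X" "Y \<in> Ob C"
  shows "Zero C X Y \<cdot> f = Zero C (Dom C f) Y"
proof -
  have X: "X \<in> Ob C" using assms by auto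
  have "Add C (Zero C X Y \<cdot> f) (Zero C X Y \<cdot> f) = Add C (Zero C X Y) (Zero C X Y) \<cdot> f"
    using assms X by (subst Add_Comp_simp) auto
  also have "\<dots> = Zero C X Y \<cdot> f" using assms X by simp
  finally show ?thesis
    by (rule Add_left_cancel) (use assms X in \<open>auto simp: in_Hom\<close>)
qed

lemma finprod_hom_group_empty [simp]:
  assumes "X \<in> Ob C" "Y \<in> Ob C"
  shows "finprod (hom_group C X Y) f {} = Zero C X Y"
proof -
  interpret H: comm_group "hom_group C X Y" by (rule hom_group[OF assms])
  show ?thesis by simp
qed

lemma finprod_hom_group_insert:
  assumes "finite I" "i \<notin> I" "\<And>j. j \<in> insert i I \<Longrightarrow> f j \<in> Hom C X Y"
  shows "finprod (hom_group C X Y) f (insert i I) = Add C (f i) (finprod (hom_group C X Y) f I)"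
proof -
  interpret H: comm_group "hom_group C X Y"
    by (rule hom_group) (use assms(3)[of i] in \<open>auto simp: in_Hom\<close>)
  show ?thesis using H.finprod_insert[of I i f] assms by auto
qed

lemma finprod_hom_group_closed:
  assumes "\<And>i. i \<in> I \<Longrightarrow> f i \<in> Hom C X Y" "X \<in> Ob C" "Y \<in> Ob C"
  shows "finprod (hom_group C X Y) f I \<in> Hom C X Y"
proof -
  interpret H: comm_group "hom_group C X Y" by (rule hom_group[OF assms(2,3)])
  show ?thesis using H.finprod_closed[of f I] assms by auto
qed

lemma finprod_hom_group_cong:
  assumes "\<And>i. i \<in> I \<Longrightarrow> f i = g i" "\<And>i. i \<in> I \<Longrightarrow> g i \<in> Hom C X Y" "X \<in> Ob C" "Y \<in> Ob C"
  shows "finprod (hom_group C X Y) f I = finprod (hom_group C X Y) g I"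
proof -
  interpret H: comm_group "hom_group C X Y" by (rule hom_group[OF assms(3,4)])
  show ?thesis by (rule H.finprod_cong') (use assms in auto)
qed

lemma Comp_finprod:
  assumes "finite I" "\<And>i. i \<in> I \<Longrightarrow> f i \<in> Hom C X Y" "g \<in> Hom C Y Z" "X \<in> Ob C"
  shows "g \<cdot> finprod (hom_group C X Y) f I = finprod (hom_group C X Z) (\<lambda>i. g \<cdot> f i) I"
  using assms(1,2)
proof (induction I)
  case empty
  then show ?case using assms(3,4) by (auto simp: in_Hom)
next
  case (insert i I)
  have "finprod (hom_group C X Y) f I \<in> Hom C X Y"
    by (rule finprod_hom_group_closed) (use insert assms(3,4) in \<open>auto simp: in_Hom\<close>)
  moreover have "f i \<in> Hom C X Y" using insert by simp
  moreover have "\<And>j. j \<in> insert i I \<Longrightarrow> g \<cdot> f j \<in> Hom C X Z"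
    using insert(4) assms(3) by (auto intro: Comp_Hom)
  ultimately show ?case
    using insert assms(3) by (subst (1 2) finprod_hom_group_insert) (auto simp: in_Hom)
qed

lemma finprod_Comp:
  assumes "finite I" "\<And>i. i \<in> I \<Longrightarrow> f i \<in> Hom C Y Z" "g \<in> Hom C X Y" "Z \<in> Ob C"
  shows "finprod (hom_group C Y Z) f I \<cdot> g = finprod (hom_group C X Z) (\<lambda>i. f i \<cdot> g) I"
  using assms(1,2)
proof (induction I)
  case empty
  then show ?case using assms(3,4) by (auto simp: in_Hom)
next
  case (insert i I)
  have "finprod (hom_group C Y Z) f I \<in> Hom C Y Z"
    by (rule finprod_hom_group_closed) (use insert assms(3,4) in \<open>auto simp: in_Hom\<close>)
  moreover have "f i \<in> Hom C Y Z" using insert by simp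
  moreover have "\<And>j. j \<in> insert i I \<Longrightarrow> f j \<cdot> g \<in> Hom C X Z"
    using insert(4) assms(3) by (auto intro: Comp_Hom)
  ultimately show ?case
    using insert assms(3) by (subst (1 2) finprod_hom_group_insert) (auto simp: in_Hom)
qed

lemma mono_arrI:
  assumes "f \<in> Hom C X Y"
    "\<And>Z x. x \<in> Hom C Z X \<Longrightarrow> f \<cdot> x = Zero C Z Y \<Longrightarrow> x = Zero C Z X"
  shows "mono_arr C f"
  unfolding mono_arr_def
proof (intro conjI allI ballI impI)
  fix Z x y assume "x \<in> Hom C Z (Dom C f)" "y \<in> Hom C Z (Dom C f)" and e: "f \<cdot> x = f \<cdot> y"
  then have x: "x \<in> Hom C Z X" and y: "y \<in> Hom C Z X" using assms(1) by (auto simp: in_Hom)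
  obtain d where d: "d \<in> Hom C Z X" "x = Add C y d" using ex_difference[OF x y] .
  have "Add C (f \<cdot> y) (f \<cdot> d) = f \<cdot> y" using e d y assms(1) by (simp add: in_Hom)
  then have "f \<cdot> d = Zero C Z Y"
    by (rule Add_left_cancel) (use d y assms(1) in \<open>auto simp: in_Hom\<close>)
  then have "d = Zero C Z X" using assms(2)[of d] d by blast
  then show "x = y" using d y by (simp add: in_Hom)
qed (use assms in \<open>simp add: in_Hom\<close>)

lemma epi_arrI:
  assumes "f \<in> Hom C X Y"
    "\<And>Z x. x \<in> Hom C Y Z \<Longrightarrow> x \<cdot> f = Zero C X Z \<Longrightarrow> x = Zero C Y Z"
  shows "epi_arr C f"
  unfolding epi_arr_def
proof (intro conjI allI ballI impI)
  fix Z x y assume "x \<in> Hom C (Cod C f) Z" "y \<in> Hom C (Cod C f) Z" and e: "x \<cdot> f = y \<cdot> f"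
  then have x: "x \<in> Hom C Y Z" and y: "y \<in> Hom C Y Z" using assms(1) by (auto simp: in_Hom)
  obtain d where d: "d \<in> Hom C Y Z" "x = Add C y d" using ex_difference[OF x y] .
  have "Add C (y \<cdot> f) (d \<cdot> f) = y \<cdot> f" using e d y assms(1) by (simp add: in_Hom)
  then have "d \<cdot> f = Zero C X Z"
    by (rule Add_left_cancel) (use d y assms(1) in \<open>auto simp: in_Hom\<close>)
  then have "d = Zero C Y Z" using assms(2)[of d] d by blast
  then show "x = y" using d y by (simp add: in_Hom)
qed (use assms in \<open>simp add: in_Hom\<close>)

lemma mono_arr_zero:
  assumes "mono_arr C m" "m \<in> Hom C X Y" "x \<in> Hom C Z X" "m \<cdot> x = Zero C Z Y"
  shows "x = Zero C Z X"
  by (rule mono_arr_cancel[OF assms(1)]) (use assms(2-4) in \<open>auto simp: in_Hom\<close>)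

lemma epi_arr_zero:
  assumes "epi_arr C e" "e \<in> Hom C X Y" "x \<in> Hom C Y Z" "x \<cdot> e = Zero C X Z"
  shows "x = Zero C Y Z"
  by (rule epi_arr_cancel[OF assms(1)]) (use assms(2-4) in \<open>auto simp: in_Hom\<close>)

end

section \<open>Short exact sequences and images\<close>

text \<open>Both universal properties are demanded, so that maps lift along \<open>k\<close> and
  descend along \<open>p\<close> already in a preadditive category. In an abelian category an epi
  with its kernel, or a mono with its cokernel, has both.\<close>

definition short_exact :: "('o, 'm, 'z) cat_scheme \<Rightarrow> 'o \<Rightarrow> 'm \<Rightarrow> 'o \<Rightarrow> 'm \<Rightarrow> 'o \<Rightarrow> bool" where
  "short_exact C K k P p X \<longleftrightarrow>
     k \<in> Hom C K P \<and> p \<in> Hom C P X \<and> is_kernel C p k \<and> is_cokernel C k p"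

context preadditive_category
begin

lemma is_kernel_ex1:
  assumes "is_kernel C f k" "f \<in> Hom C X Y" "g \<in> Hom C Z X" "f \<cdot> g = Zero C Z Y"
  shows "\<exists>!h. h \<in> Hom C Z (Dom C k) \<and> k \<cdot> h = g"
proof -
  have "Dom C f = X" "Cod C f = Y" using assms(2) by (simp_all add: in_Hom)
  with assms(1,3,4) show ?thesis unfolding is_kernel_def by blast
qed

lemma is_kernelD:
  assumes "is_kernel C f k" "f \<in> Hom C X Y"
  shows "k \<in> Hom C (Dom C k) X" "f \<cdot> k = Zero C (Dom C k) Y" "mono_arr C k"
proof -
  show k: "k \<in> Hom C (Dom C k) X" "f \<cdot> k = Zero C (Dom C k) Y"
    using assms by (auto simp: is_kernel_def in_Hom)
  show "mono_arr C k"
  proof (rule mono_arrI)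
    fix Z x assume x: "x \<in> Hom C Z (Dom C k)" "k \<cdot> x = Zero C Z X"
    have ob: "Z \<in> Ob C" "X \<in> Ob C" "Dom C k \<in> Ob C" using x(1) k(1) by (auto simp: in_Hom)
    have "Zero C Z X \<in> Hom C Z X" "f \<cdot> Zero C Z X = Zero C Z Y"
      using ob assms(2) by (auto simp: in_Hom)
    note ex1 = is_kernel_ex1[OF assms this]
    have "Zero C Z (Dom C k) \<in> Hom C Z (Dom C k)" "k \<cdot> Zero C Z (Dom C k) = Zero C Z X"
      using ob k(1) by (auto simp: in_Hom)
    with ex1 x show "x = Zero C Z (Dom C k)" by blast
  qed (rule k)
qed

lemma is_kernel_lift:
  assumes "is_kernel C f k" "f \<in> Hom C X Y" "g \<in> Hom C Z X" "f \<cdot> g = Zero C Z Y"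
  obtains h where "h \<in> Hom C Z (Dom C k)" "k \<cdot> h = g"
  using is_kernel_ex1[OF assms] by blast

lemma is_kernelI:
  assumes "f \<in> Hom C X Y" "k \<in> Hom C K X" "f \<cdot> k = Zero C K Y" "mono_arr C k"
    "\<And>Z g. g \<in> Hom C Z X \<Longrightarrow> f \<cdot> g = Zero C Z Y \<Longrightarrow> \<exists>h \<in> Hom C Z K. k \<cdot> h = g"
  shows "is_kernel C f k"
  unfolding is_kernel_def
proof (intro conjI allI ballI impI)
  fix Z g assume "g \<in> Hom C Z (Dom C f)" "f \<cdot> g = Zero C Z (Cod C f)"
  then obtain h where h: "h \<in> Hom C Z K" "k \<cdot> h = g"
    using assms(1) assms(5)[of g Z] by (auto simp: in_Hom)
  show "\<exists>!h. h \<in> Hom C Z (Dom C k) \<and> k \<cdot> h = g"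
  proof (rule ex1I)
    show "h \<in> Hom C Z (Dom C k) \<and> k \<cdot> h = g" using h assms(2) by (auto simp: in_Hom)
    fix h' assume h': "h' \<in> Hom C Z (Dom C k) \<and> k \<cdot> h' = g"
    show "h' = h" by (rule mono_arr_cancel[OF assms(4)]) (use h h' assms(2) in \<open>auto simp: in_Hom\<close>)
  qed
qed (use assms(1-3) in \<open>auto simp: in_Hom\<close>)

lemma is_cokernel_ex1:
  assumes "is_cokernel C f c" "f \<in> Hom C X Y" "g \<in> Hom C Y Z" "g \<cdot> f = Zero C X Z"
  shows "\<exists>!h. h \<in> Hom C (Cod C c) Z \<and> h \<cdot> c = g"
proof -
  have "Dom C f = X" "Cod C f = Y" using assms(2) by (simp_all add: in_Hom)
  with assms(1,3,4) show ?thesis unfolding is_cokernel_def by blast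
qed

lemma is_cokernelD:
  assumes "is_cokernel C f c" "f \<in> Hom C X Y"
  shows "c \<in> Hom C Y (Cod C c)" "c \<cdot> f = Zero C X (Cod C c)" "epi_arr C c"
proof -
  show c: "c \<in> Hom C Y (Cod C c)" "c \<cdot> f = Zero C X (Cod C c)"
    using assms by (auto simp: is_cokernel_def in_Hom)
  show "epi_arr C c"
  proof (rule epi_arrI)
    fix Z x assume x: "x \<in> Hom C (Cod C c) Z" "x \<cdot> c = Zero C Y Z"
    have ob: "Z \<in> Ob C" "Y \<in> Ob C" "Cod C c \<in> Ob C" using x(1) c(1) by (auto simp: in_Hom)
    have "Zero C Y Z \<in> Hom C Y Z" "Zero C Y Z \<cdot> f = Zero C X Z"
      using ob assms(2) by (auto simp: in_Hom)
    note ex1 = is_cokernel_ex1[OF assms this]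
    have "Zero C (Cod C c) Z \<in> Hom C (Cod C c) Z" "Zero C (Cod C c) Z \<cdot> c = Zero C Y Z"
      using ob c(1) by (auto simp: in_Hom)
    with ex1 x show "x = Zero C (Cod C c) Z" by blast
  qed (rule c)
qed

lemma is_cokernel_colift:
  assumes "is_cokernel C f c" "f \<in> Hom C X Y" "g \<in> Hom C Y Z" "g \<cdot> f = Zero C X Z"
  obtains h where "h \<in> Hom C (Cod C c) Z" "h \<cdot> c = g"
  using is_cokernel_ex1[OF assms] by blast

lemma is_cokernelI:
  assumes "f \<in> Hom C X Y" "c \<in> Hom C Y D" "c \<cdot> f = Zero C X D" "epi_arr C c"
    "\<And>Z g. g \<in> Hom C Y Z \<Longrightarrow> g \<cdot> f = Zero C X Z \<Longrightarrow> \<exists>h \<in> Hom C D Z. h \<cdot> c = g"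
  shows "is_cokernel C f c"
  unfolding is_cokernel_def
proof (intro conjI allI ballI impI)
  fix Z g assume "g \<in> Hom C (Cod C f) Z" "g \<cdot> f = Zero C (Dom C f) Z"
  then obtain h where h: "h \<in> Hom C D Z" "h \<cdot> c = g"
    using assms(1) assms(5)[of g Z] by (auto simp: in_Hom)
  show "\<exists>!h. h \<in> Hom C (Cod C c) Z \<and> h \<cdot> c = g"
  proof (rule ex1I)
    show "h \<in> Hom C (Cod C c) Z \<and> h \<cdot> c = g" using h assms(2) by (auto simp: in_Hom)
    fix h' assume h': "h' \<in> Hom C (Cod C c) Z \<and> h' \<cdot> c = g"
    show "h' = h" by (rule epi_arr_cancel[OF assms(4)]) (use h h' assms(2) in \<open>auto simp: in_Hom\<close>)
  qed
qed (use assms(1-3) in \<open>auto simp: in_Hom\<close>)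

lemma short_exactD:
  assumes "short_exact C K k P p X"
  shows "k \<in> Hom C K P" "p \<in> Hom C P X" "p \<cdot> k = Zero C K X" "mono_arr C k" "epi_arr C p"
    "is_kernel C p k" "is_cokernel C k p" "K \<in> Ob C" "P \<in> Ob C" "X \<in> Ob C"
  using assms is_kernelD[of p k P X] is_cokernelD[of k p K P]
  by (auto simp: short_exact_def in_Hom)

lemma short_exact_lift:
  assumes "short_exact C K k P p X" "g \<in> Hom C Z P" "p \<cdot> g = Zero C Z X"
  obtains h where "h \<in> Hom C Z K" "k \<cdot> h = g"
  using is_kernel_lift[OF short_exactD(6,2)[OF assms(1)] assms(2,3)] short_exactD(1)[OF assms(1)]
  by (auto simp: in_Hom)

lemma short_exact_colift:
  assumes "short_exact C K k P p X" "g \<in> Hom C P Z" "g \<cdot> k = Zero C K Z"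
  obtains h where "h \<in> Hom C X Z" "h \<cdot> p = g"
  using is_cokernel_colift[OF short_exactD(7,1)[OF assms(1)] assms(2,3)] short_exactD(2)[OF assms(1)]
  by (auto simp: in_Hom)

text \<open>Used with \<open>f\<close> an identity: an endomorphism of the middle term that induces
  the identity on \<open>X\<close> is corrected by a term through \<open>K\<close>. The dual below
  corrects by a term through \<open>X\<close>. These corrections are the source of all error terms
  in stable decompositions.\<close>

lemma short_exact_lift_difference:
  assumes "short_exact C K k P p X" "f \<in> Hom C Z P" "g \<in> Hom C Z P" "p \<cdot> f = p \<cdot> g"
  obtains h where "h \<in> Hom C Z K" "f = Add C g (k \<cdot> h)"
proof -
  note S = short_exactD[OF assms(1)]
  obtain d where d: "d \<in> Hom C Z P" "f = Add C g d" using ex_difference[OF assms(2,3)] .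
  have "Add C (p \<cdot> g) (p \<cdot> d) = p \<cdot> g" using assms d S by (simp add: in_Hom)
  then have "p \<cdot> d = Zero C Z X"
    by (rule Add_left_cancel) (use d assms S in \<open>auto simp: in_Hom\<close>)
  from short_exact_lift[OF assms(1) d(1) this] show ?thesis using that d by metis
qed

lemma short_exact_colift_difference:
  assumes "short_exact C K k P p X" "f \<in> Hom C P Z" "g \<in> Hom C P Z" "f \<cdot> k = g \<cdot> k"
  obtains h where "h \<in> Hom C X Z" "f = Add C g (h \<cdot> p)"
proof -
  note S = short_exactD[OF assms(1)]
  obtain d where d: "d \<in> Hom C P Z" "f = Add C g d" using ex_difference[OF assms(2,3)] .
  have "Add C (g \<cdot> k) (d \<cdot> k) = g \<cdot> k" using assms d S by (simp add: in_Hom)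
  then have "d \<cdot> k = Zero C K Z"
    by (rule Add_left_cancel) (use d assms S in \<open>auto simp: in_Hom\<close>)
  from short_exact_colift[OF assms(1) d(1) this] show ?thesis using that d by metis
qed

end

section \<open>Factorizations, images and exactness in abelian categories\<close>

context abelian_category
begin

text \<open>In an abelian category \<open>p\<close> is the cokernel of some \<open>g\<close>. Since
  \<open>p \<cdot> g\<close> vanishes, \<open>g\<close> factors through \<open>k\<close>; so
  whatever kills \<open>k\<close> kills \<open>g\<close> and descends along
  \<open>p\<close>.\<close>

lemma epi_short_exact:
  assumes "epi_arr C p" "p \<in> Hom C P X" "is_kernel C p k"
  shows "short_exact C (Dom C k) k P p X"
proof -
  note k = is_kernelD[OF assms(3,2)]
  obtain g where g: "is_cokernel C g p" using epi_is_cokernel[OF assms(1)] by blast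
  then have gt: "g \<in> Hom C (Dom C g) P" using assms(2) by (auto simp: is_cokernel_def in_Hom)
  note gp = is_cokernelD[OF g gt]
  obtain g' where g': "g' \<in> Hom C (Dom C g) (Dom C k)" "k \<cdot> g' = g"
    using is_kernel_lift[OF assms(3,2) gt] gp assms(2) by (auto simp: in_Hom)
  have "is_cokernel C k p"
  proof (rule is_cokernelI[OF k(1) assms(2) k(2) assms(1)])
    fix Z t assume t: "t \<in> Hom C P Z" "t \<cdot> k = Zero C (Dom C k) Z"
    have "t \<cdot> g = (t \<cdot> k) \<cdot> g'" using g' t(1) k(1) by (auto simp: in_Hom)
    also have "\<dots> = Zero C (Dom C g) Z" using g' t by (auto simp: in_Hom)
    finally obtain h where "h \<in> Hom C (Cod C p) Z" "h \<cdot> p = t"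
      using is_cokernel_colift[OF g gt t(1)] by blast
    then show "\<exists>h\<in>Hom C X Z. h \<cdot> p = t" using assms(2) by (auto simp: in_Hom)
  qed
  then show ?thesis using assms k by (simp add: short_exact_def)
qed

lemma mono_short_exact:
  assumes "mono_arr C k" "k \<in> Hom C K P" "is_cokernel C k p"
  shows "short_exact C K k P p (Cod C p)"
proof -
  note p = is_cokernelD[OF assms(3,2)]
  obtain g where g: "is_kernel C g k" using mono_is_kernel[OF assms(1)] by blast
  then have gt: "g \<in> Hom C P (Cod C g)" using assms(2) by (auto simp: is_kernel_def in_Hom)
  note gk = is_kernelD[OF g gt]
  obtain g' where g': "g' \<in> Hom C (Cod C p) (Cod C g)" "g' \<cdot> p = g"
    using is_cokernel_colift[OF assms(3,2) gt] gk assms(2) by (auto simp: in_Hom)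
  have "is_kernel C p k"
  proof (rule is_kernelI[OF p(1) assms(2) p(2) assms(1)])
    fix Z t assume t: "t \<in> Hom C Z P" "p \<cdot> t = Zero C Z (Cod C p)"
    have "g \<cdot> t = g' \<cdot> (p \<cdot> t)" using g' t(1) p(1) by (auto simp: in_Hom)
    also have "\<dots> = Zero C Z (Cod C g)" using g' t(1) unfolding t(2) by (auto simp: in_Hom)
    finally obtain h where "h \<in> Hom C Z (Dom C k)" "k \<cdot> h = t"
      using is_kernel_lift[OF g gt t(1)] by blast
    then show "\<exists>h\<in>Hom C Z K. k \<cdot> h = t" using assms(2) by (auto simp: in_Hom)
  qed
  then show ?thesis using assms p by (simp add: short_exact_def)
qed

lemma ex_epi_short_exact:
  assumes "epi_arr C p" "p \<in> Hom C P X"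
  obtains K k where "short_exact C K k P p X"
  using kernels[of p] epi_short_exact[OF assms] assms(2) by (auto simp: in_Hom)

lemma ex_mono_short_exact:
  assumes "mono_arr C k" "k \<in> Hom C K P"
  obtains p X where "short_exact C K k P p X"
  using cokernels[of k] mono_short_exact[OF assms] assms(2) by (auto simp: in_Hom)

text \<open>The point is that \<open>q\<close> is epi. If \<open>t\<close> kills \<open>q\<close>,
  then \<open>f\<close> factors through \<open>m \<cdot> n\<close>, where \<open>n\<close> is the
  kernel of \<open>t\<close>. The cokernel of \<open>m \<cdot> n\<close> kills \<open>f\<close>,
  hence also \<open>m\<close>, so \<open>m\<close> factors through \<open>m \<cdot> n\<close>. Thus
  \<open>n\<close> has a right inverse and \<open>t\<close> is zero.\<close>

lemma is_image_factorization:
  assumes "is_image C f m" "f \<in> Hom C X Y"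
  obtains q where "q \<in> Hom C X (Dom C m)" "m \<in> Hom C (Dom C m) Y" "epi_arr C q" "mono_arr C m" "m \<cdot> q = f"
proof -
  obtain c where c: "is_cokernel C f c" "is_kernel C c m" using assms by (auto simp: is_image_def)
  note cD = is_cokernelD[OF c(1) assms(2)]
  note m = is_kernelD[OF c(2) cD(1)]
  obtain q where q: "q \<in> Hom C X (Dom C m)" "m \<cdot> q = f"
    using is_kernel_lift[OF c(2) cD(1) assms(2) cD(2)] .
  have "epi_arr C q"
  proof (rule epi_arrI[OF q(1)])
    fix Z t assume t: "t \<in> Hom C (Dom C m) Z" "t \<cdot> q = Zero C X Z"
    obtain n where n: "is_kernel C t n" using kernels t(1) by (auto simp: in_Hom)
    note nD = is_kernelD[OF n t(1)]
    obtain q' where q': "q' \<in> Hom C X (Dom C n)" "n \<cdot> q' = q" using is_kernel_lift[OF n t(1) q(1) t(2)] .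
    have mn: "m \<cdot> n \<in> Hom C (Dom C n) Y" using m nD by (auto simp: in_Hom)
    have "mono_arr C (m \<cdot> n)" by (rule mono_arr_Comp) (use m nD in \<open>auto simp: in_Hom\<close>)
    from ex_mono_short_exact[OF this mn] obtain g W where g: "short_exact C (Dom C n) (m \<cdot> n) Y g W" .
    note gD = short_exactD[OF g]
    have "g \<cdot> f = (g \<cdot> (m \<cdot> n)) \<cdot> q'" using q' q m nD(1) gD(2) by (auto simp: in_Hom)
    also have "\<dots> = Zero C X W" using q' gD(2) unfolding gD(3) by (auto simp: in_Hom)
    finally obtain g' where g': "g' \<in> Hom C (Cod C c) W" "g' \<cdot> c = g"
      using is_cokernel_colift[OF c(1) assms(2) gD(2)] by blast
    have "g \<cdot> m = g' \<cdot> (c \<cdot> m)" using g' m(1) cD(1) by (auto simp: in_Hom)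
    also have "\<dots> = Zero C (Dom C m) W" using g' m(1) unfolding m(2) by (auto simp: in_Hom)
    finally obtain v where v: "v \<in> Hom C (Dom C m) (Dom C n)" "(m \<cdot> n) \<cdot> v = m"
      using short_exact_lift[OF g m(1)] by blast
    have "n \<cdot> v = Ide C (Dom C m)"
      by (rule mono_arr_cancel[OF m(3)]) (use v nD(1) m(1) in \<open>auto simp: in_Hom\<close>)
    then have "t = (t \<cdot> n) \<cdot> v" using v nD(1) t(1) m(1) by (auto simp: in_Hom)
    also have "\<dots> = Zero C (Dom C m) Z" using v(1) t(1) unfolding nD(2) by (auto simp: in_Hom)
    finally show "t = Zero C (Dom C m) Z" .
  qed
  then show ?thesis using that q m by blast
qed

lemma ex_factorization:
  assumes "f \<in> Hom C X Y"
  obtains I q m where "q \<in> Hom C X I" "m \<in> Hom C I Y" "epi_arr C q" "mono_arr C m" "f = m \<cdot> q"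
proof -
  obtain c where c: "is_cokernel C f c" using cokernels assms by (auto simp: in_Hom)
  then obtain m where "is_kernel C c m" using kernels[of c] unfolding is_cokernel_def by blast
  with c have "is_image C f m" by (auto simp: is_image_def)
  from is_image_factorization[OF this assms] show ?thesis using that by metis
qed

lemma is_kernel_mono_Comp:
  assumes "mono_arr C m" "m \<in> Hom C Y Z" "q \<in> Hom C X Y"
  shows "is_kernel C (m \<cdot> q) k \<longleftrightarrow> is_kernel C q k"
proof -
  have t: "m \<cdot> q \<in> Hom C X Z" using assms by (auto simp: in_Hom)
  have *: "q \<cdot> x = Zero C W Y" if "x \<in> Hom C W X" "(m \<cdot> q) \<cdot> x = Zero C W Z" for x W
    by (rule mono_arr_zero[OF assms(1,2)]) (use that assms in \<open>auto simp: in_Hom\<close>)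
  have **: "(m \<cdot> q) \<cdot> x = Zero C W Z" if "x \<in> Hom C W X" "q \<cdot> x = Zero C W Y" for x W
    using that assms by (auto simp: in_Hom)
  show ?thesis
  proof
    assume k: "is_kernel C (m \<cdot> q) k"
    note kD = is_kernelD[OF k t]
    show "is_kernel C q k"
      by (rule is_kernelI[OF assms(3) kD(1) *[OF kD(1,2)] kD(3)])
        (metis is_kernel_lift[OF k t] **)
  next
    assume k: "is_kernel C q k"
    note kD = is_kernelD[OF k assms(3)]
    show "is_kernel C (m \<cdot> q) k"
      by (rule is_kernelI[OF t kD(1) **[OF kD(1,2)] kD(3)])
        (metis is_kernel_lift[OF k assms(3)] *)
  qed
qed

lemma is_image_epi_mono:
  assumes "epi_arr C q" "q \<in> Hom C X Y" "mono_arr C m" "m \<in> Hom C Y Z"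
  shows "is_image C (m \<cdot> q) m"
proof -
  obtain c W where c: "short_exact C Y m Z c W" using ex_mono_short_exact[OF assms(3,4)] .
  note cD = short_exactD[OF c]
  have t: "m \<cdot> q \<in> Hom C X Z" using assms by (auto simp: in_Hom)
  have cmq: "c \<cdot> (m \<cdot> q) = Zero C X W"
    using pre_comp[OF cD(3), of q] assms cD(1,2) by (auto simp: in_Hom)
  have "is_cokernel C (m \<cdot> q) c"
  proof (rule is_cokernelI[OF t cD(2) cmq cD(5)])
    fix V g assume g: "g \<in> Hom C Z V" "g \<cdot> (m \<cdot> q) = Zero C X V"
    have "g \<cdot> m = Zero C Y V"
      by (rule epi_arr_zero[OF assms(1,2)]) (use g assms in \<open>auto simp: in_Hom\<close>)
    then show "\<exists>h\<in>Hom C W V. h \<cdot> c = g" using short_exact_colift[OF c g(1)] by blast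
  qed
  then show ?thesis using cD(6) by (auto simp: is_image_def)
qed

text \<open>\<open>exact_at\<close> provides some image \<open>m'\<close>; this replaces it by
  whichever epi-mono factorization is at hand. The cokernel of \<open>m\<close> kills
  \<open>m'\<close>, as is seen after composing with the epi \<open>q'\<close>, so \<open>m'\<close>
  factors through \<open>m\<close>.\<close>

lemma exact_at_iff:
  assumes "epi_arr C q" "q \<in> Hom C X I" "mono_arr C m" "m \<in> Hom C I Y" "g \<in> Hom C Y Z"
  shows "exact_at C (m \<cdot> q) g \<longleftrightarrow> is_kernel C g m"
proof
  assume "is_kernel C g m"
  then show "exact_at C (m \<cdot> q) g" using is_image_epi_mono[OF assms(1-4)] by (auto simp: exact_at_def)
next
  assume "exact_at C (m \<cdot> q) g"
  then obtain m' where m': "is_image C (m \<cdot> q) m'" "is_kernel C g m'" by (auto simp: exact_at_def)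
  have t: "m \<cdot> q \<in> Hom C X Y" using assms by (auto simp: in_Hom)
  obtain q' where q': "q' \<in> Hom C X (Dom C m')" "m' \<in> Hom C (Dom C m') Y" "epi_arr C q'" "mono_arr C m'" "m' \<cdot> q' = m \<cdot> q"
    using is_image_factorization[OF m'(1) t] .
  obtain c W where c: "short_exact C I m Y c W" using ex_mono_short_exact[OF assms(3,4)] .
  note cD = short_exactD[OF c]
  note kD = is_kernelD[OF m'(2) assms(5)]
  have gm: "g \<cdot> m = Zero C I Z"
  proof (rule epi_arr_zero[OF assms(1,2)])
    have "(g \<cdot> m) \<cdot> q = (g \<cdot> m') \<cdot> q'" using q' assms by (auto simp: in_Hom)
    also have "\<dots> = Zero C X Z" using q'(1) assms(5) unfolding kD(2) by (auto simp: in_Hom)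
    finally show "(g \<cdot> m) \<cdot> q = Zero C X Z" .
  qed (use assms in \<open>auto simp: in_Hom\<close>)
  have cm': "c \<cdot> m' = Zero C (Dom C m') W"
  proof (rule epi_arr_zero[OF q'(3,1)])
    have "(c \<cdot> m') \<cdot> q' = (c \<cdot> m) \<cdot> q" using q' assms cD(2) by (auto simp: in_Hom)
    also have "\<dots> = Zero C X W" using assms(2) cD(2) unfolding cD(3) by (auto simp: in_Hom)
    finally show "(c \<cdot> m') \<cdot> q' = Zero C X W" .
  qed (use q' cD in \<open>auto simp: in_Hom\<close>)
  obtain u where u: "u \<in> Hom C (Dom C m') I" "m \<cdot> u = m'" using short_exact_lift[OF c kD(1) cm'] .
  show "is_kernel C g m"
  proof (rule is_kernelI[OF assms(5,4) gm assms(3)])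
    fix V h assume "h \<in> Hom C V Y" "g \<cdot> h = Zero C V Z"
    then obtain x where "x \<in> Hom C V (Dom C m')" "m' \<cdot> x = h" using is_kernel_lift[OF m'(2) assms(5)] by blast
    then show "\<exists>h'\<in>Hom C V I. m \<cdot> h' = h" using u assms(4) by (intro bexI[of _ "u \<cdot> x"]) (simp_all add: in_Hom pre_comp[OF u(2), of x])
  qed
qed

text \<open>\<open>torsionfree\<close> constrains every image of each map, so an arbitrary image has
  to be compared with the mono of a known factorization. Both are kernels of the same
  cokernel.\<close>

lemma is_image_mono_retract:
  assumes "epi_arr C q" "q \<in> Hom C X I" "mono_arr C m" "m \<in> Hom C I Y" "is_image C (m \<cdot> q) m'"
  obtains u v where "u \<in> Hom C (Dom C m') I" "v \<in> Hom C I (Dom C m')" "m \<cdot> u = m'" "m' \<cdot> v = m" "mono_arr C m'" "m' \<in> Hom C (Dom C m') Y" "v \<cdot> u = Ide C (Dom C m')"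
proof -
  have t: "m \<cdot> q \<in> Hom C X Y" using assms by (auto simp: in_Hom)
  obtain c where c: "is_cokernel C (m \<cdot> q) c" "is_kernel C c m'" using assms(5) by (auto simp: is_image_def)
  note cD = is_cokernelD[OF c(1) t]
  have "exact_at C (m \<cdot> q) c" using assms(5) c by (auto simp: exact_at_def)
  then have k: "is_kernel C c m" using exact_at_iff[OF assms(1-4) cD(1)] by simp
  note kD = is_kernelD[OF k cD(1)] and kD' = is_kernelD[OF c(2) cD(1)]
  obtain u where u: "u \<in> Hom C (Dom C m') I" "m \<cdot> u = m'"
    using is_kernel_lift[OF k cD(1) kD'(1,2)] assms(4) by (auto simp: in_Hom)
  obtain v where v: "v \<in> Hom C I (Dom C m')" "m' \<cdot> v = m"
    using is_kernel_lift[OF c(2) cD(1) kD(1,2)] assms(4) by (auto simp: in_Hom)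
  have "v \<cdot> u = Ide C (Dom C m')"
    by (rule mono_arr_cancel[OF kD'(3)])
      (use u v kD'(1) pre_comp[OF v(2), of u] assms(4) in \<open>auto simp: in_Hom\<close>)
  with u v kD' that show ?thesis by blast
qed

end

section \<open>Projective objects and stable retracts\<close>

text \<open>\<open>A\<close> is a retract of \<open>B\<close> in the stable category, i.e. modulo morphisms that factor through
  a projective object.\<close>

definition stable_retract :: "('o, 'm, 'z) cat_scheme \<Rightarrow> 'o \<Rightarrow> 'o \<Rightarrow> bool" where
  "stable_retract C A B \<longleftrightarrow> (\<exists>s \<in> Hom C A B. \<exists>r \<in> Hom C B A. \<exists>Q. projective C Q \<and>
     (\<exists>u \<in> Hom C A Q. \<exists>v \<in> Hom C Q A. Ide C A = Add C (r \<cdot>\<^bsub>C\<^esub> s) (v \<cdot>\<^bsub>C\<^esub> u)))"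

context abelian_category
begin

lemma projective_lift:
  assumes "projective C P" "epi_arr C e" "e \<in> Hom C A B" "f \<in> Hom C P B"
  obtains h where "h \<in> Hom C P A" "e \<cdot> h = f"
  using assms unfolding projective_def by blast

lemma projective_Ob [simp]: "projective C P \<Longrightarrow> P \<in> Ob C"
  by (simp add: projective_def)

lemma projective_retract:
  assumes "projective C P" "s \<in> Hom C A P" "r \<in> Hom C P A" "r \<cdot> s = Ide C A"
  shows "projective C A"
  unfolding projective_def
proof (intro conjI allI ballI impI)
  fix X Y g f assume g: "g \<in> Hom C X Y" "epi_arr C g" and f: "f \<in> Hom C A Y"
  have "f \<cdot> r \<in> Hom C P Y" using f assms by (simp add: in_Hom)
  then obtain h where h: "h \<in> Hom C P X" "g \<cdot> h = f \<cdot> r" using projective_lift[OF assms(1) g(2,1)] by blast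
  have "g \<cdot> (h \<cdot> s) = f"
    using pre_comp[OF h(2), of s] f g h assms by (simp add: in_Hom)
  then show "\<exists>h\<in>Hom C A X. g \<cdot> h = f" using h assms by (intro bexI[of _ "h \<cdot> s"]) (simp_all add: in_Hom)
qed (use assms in \<open>auto simp: in_Hom\<close>)

lemma ex_biproduct:
  assumes "A \<in> Ob C" "B \<in> Ob C"
  obtains R i j p q where "i \<in> Hom C A R" "j \<in> Hom C B R" "p \<in> Hom C R A" "q \<in> Hom C R B"
    "p \<cdot> i = Ide C A" "q \<cdot> j = Ide C B" "p \<cdot> j = Zero C B A" "q \<cdot> i = Zero C A B"
    "Ide C R = Add C (i \<cdot> p) (j \<cdot> q)"
proof -
  define Y where "Y n = (if n = 0 then A else B)" for n :: nat
  obtain R \<iota> \<pi> where R: "is_direct_sum C 2 Y R \<iota> \<pi>"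
    using direct_sums[of 2 Y] assms unfolding Y_def by force
  have t: "\<iota> 0 \<in> Hom C A R" "\<iota> 1 \<in> Hom C B R" "\<pi> 0 \<in> Hom C R A" "\<pi> 1 \<in> Hom C R B"
    using R by (auto simp: is_direct_sum_def Y_def dest: spec[of _ 0] spec[of _ 1])
  have e: "\<pi> 0 \<cdot> \<iota> 0 = Ide C A" "\<pi> 1 \<cdot> \<iota> 1 = Ide C B" "\<pi> 0 \<cdot> \<iota> 1 = Zero C B A" "\<pi> 1 \<cdot> \<iota> 0 = Zero C A B"
    using R by (auto simp: is_direct_sum_def Y_def dest: spec[of _ 0] spec[of _ 1])
  have "Ide C R = finprod (hom_group C R R) (\<lambda>i. \<iota> i \<cdot> \<pi> i) (insert 0 (insert 1 {}))"
    using R by (simp add: is_direct_sum_def lessThan_Suc numeral_2_eq_2 insert_commute)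
  also have "\<dots> = Add C (\<iota> 0 \<cdot> \<pi> 0) (\<iota> 1 \<cdot> \<pi> 1)"
    using t by (subst finprod_hom_group_insert, simp, simp, force simp: in_Hom)
      (subst finprod_hom_group_insert, auto simp: in_Hom)
  finally show ?thesis using that t e by blast
qed

text \<open>\<open>R\<close> is the biproduct of \<open>P\<close> and \<open>Q\<close>. Its use: a
  sum of two maps that factor through projectives factors through a single projective.\<close>

lemma ex_projective_pairing:
  assumes "projective C P" "projective C Q" "f \<in> Hom C X P" "g \<in> Hom C X Q"
  obtains R h p q where "projective C R" "h \<in> Hom C X R" "p \<in> Hom C R P" "q \<in> Hom C R Q" "p \<cdot> h = f" "q \<cdot> h = g"
proof -
  obtain R i j p q where R: "i \<in> Hom C P R" "j \<in> Hom C Q R" "p \<in> Hom C R P" "q \<in> Hom C R Q"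
    "p \<cdot> i = Ide C P" "q \<cdot> j = Ide C Q" "p \<cdot> j = Zero C Q P" "q \<cdot> i = Zero C P Q"
    "Ide C R = Add C (i \<cdot> p) (j \<cdot> q)"
    using ex_biproduct[of P Q] assms by (metis projective_Ob)
  have "projective C R"
    unfolding projective_def
  proof (intro conjI allI ballI impI)
    fix Y Z e t assume e: "e \<in> Hom C Y Z" "epi_arr C e" and t: "t \<in> Hom C R Z"
    obtain a where a: "a \<in> Hom C P Y" "e \<cdot> a = t \<cdot> i"
      using projective_lift[OF assms(1) e(2,1), of "t \<cdot> i"] t R by (auto simp: in_Hom)
    obtain b where b: "b \<in> Hom C Q Y" "e \<cdot> b = t \<cdot> j"
      using projective_lift[OF assms(2) e(2,1), of "t \<cdot> j"] t R by (auto simp: in_Hom)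
    have "t = t \<cdot> Add C (i \<cdot> p) (j \<cdot> q)" using t R(9)[symmetric] by (simp add: in_Hom)
    also have "\<dots> = e \<cdot> Add C (a \<cdot> p) (b \<cdot> q)"
      using pre_comp[OF a(2), of p] pre_comp[OF b(2), of q] a(1) b(1) e(1) R(1-4) t
      by (simp add: in_Hom)
    finally show "\<exists>h\<in>Hom C R Y. e \<cdot> h = t"
      using a b R by (intro bexI[of _ "Add C (a \<cdot> p) (b \<cdot> q)"]) (simp_all add: in_Hom)
  qed (use R in \<open>auto simp: in_Hom\<close>)
  moreover have "p \<cdot> Add C (i \<cdot> f) (j \<cdot> g) = f" "q \<cdot> Add C (i \<cdot> f) (j \<cdot> g) = g"
    using pre_comp[OF R(5), of f] pre_comp[OF R(7), of g] pre_comp[OF R(8), of f]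
      pre_comp[OF R(6), of g] R(1-4) assms by (simp_all add: in_Hom)
  moreover have "Add C (i \<cdot> f) (j \<cdot> g) \<in> Hom C X R"
    using R assms by (simp add: in_Hom)
  ultimately show ?thesis using that R by blast
qed

lemma stable_retractI:
  assumes "s \<in> Hom C A B" "r \<in> Hom C B A" "projective C Q" "u \<in> Hom C A Q" "v \<in> Hom C Q A"
    "Ide C A = Add C (r \<cdot> s) (v \<cdot> u)"
  shows "stable_retract C A B"
  using assms unfolding stable_retract_def by blast

lemma stable_retractE:
  assumes "stable_retract C A B"
  obtains s r Q u v where "s \<in> Hom C A B" "r \<in> Hom C B A" "projective C Q" "u \<in> Hom C A Q" "v \<in> Hom C Q A"
    "Ide C A = Add C (r \<cdot> s) (v \<cdot> u)"
  using assms unfolding stable_retract_def by blast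

text \<open>Placing the decomposition of the identity of \<open>B\<close> between \<open>s\<close>
  and \<open>r\<close> leaves two error terms, one through \<open>Q'\<close> and one through
  \<open>Q\<close>; \<open>ex_projective_pairing\<close> merges them.\<close>

lemma stable_retract_trans:
  assumes "stable_retract C A B" "stable_retract C B D"
  shows "stable_retract C A D"
proof -
  obtain s r Q u v where a: "s \<in> Hom C A B" "r \<in> Hom C B A" "projective C Q" "u \<in> Hom C A Q" "v \<in> Hom C Q A"
    "Ide C A = Add C (r \<cdot> s) (v \<cdot> u)" using assms(1) by (rule stable_retractE)
  obtain s' r' Q' u' v' where b: "s' \<in> Hom C B D" "r' \<in> Hom C D B" "projective C Q'" "u' \<in> Hom C B Q'" "v' \<in> Hom C Q' B"
    "Ide C B = Add C (r' \<cdot> s') (v' \<cdot> u')" using assms(2) by (rule stable_retractE)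
  have us: "u' \<cdot> s \<in> Hom C A Q'" using a b by (simp add: in_Hom)
  obtain R h p q where R: "projective C R" "h \<in> Hom C A R" "p \<in> Hom C R Q'" "q \<in> Hom C R Q" "p \<cdot> h = u' \<cdot> s" "q \<cdot> h = u"
    using ex_projective_pairing[OF b(3) a(3) us a(4)] .
  let ?v = "Add C (r \<cdot> (v' \<cdot> p)) (v \<cdot> q)"
  have "Ide C A = Add C (r \<cdot> (Add C (r' \<cdot> s') (v' \<cdot> u') \<cdot> s)) (v \<cdot> u)"
    using a b(6)[symmetric] by (simp add: in_Hom)
  also have "\<dots> = Add C ((r \<cdot> r') \<cdot> (s' \<cdot> s)) (Add C (r \<cdot> (v' \<cdot> (u' \<cdot> s))) (v \<cdot> u))"
    using a(1-5) b(1-5) by (simp add: in_Hom Add_assoc)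
  also have "Add C (r \<cdot> (v' \<cdot> (u' \<cdot> s))) (v \<cdot> u) = ?v \<cdot> h"
    using a(1-5) b(1-5) R by (simp add: in_Hom)
  finally show ?thesis
    by (rule stable_retractI[rotated 5]) (use a b R in \<open>simp_all add: in_Hom\<close>)
qed

lemma left_proj_approx_extend:
  assumes "left_proj_approx C k" "k \<in> Hom C K P" "projective C Q" "g \<in> Hom C K Q"
  obtains h where "h \<in> Hom C P Q" "h \<cdot> k = g"
proof -
  have "Dom C k = K" "Cod C k = P" using assms(2) by (simp_all add: in_Hom)
  with assms(1,3,4) show ?thesis using that unfolding left_proj_approx_def by blast
qed

lemma left_proj_approxI:
  assumes "k \<in> Hom C K P" "projective C P"
    "\<And>Q g. projective C Q \<Longrightarrow> g \<in> Hom C K Q \<Longrightarrow> \<exists>h \<in> Hom C P Q. h \<cdot> k = g"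
  shows "left_proj_approx C k"
proof -
  have "k \<in> Arr C" "Dom C k = K" "Cod C k = P" using assms(1) by (simp_all add: in_Hom)
  then show ?thesis using assms(2,3) unfolding left_proj_approx_def by blast
qed

lemma left_proj_approx_projective:
  assumes "left_proj_approx C k" "k \<in> Hom C K P"
  shows "projective C P"
  using assms by (simp add: left_proj_approx_def in_Hom)

text \<open>Projectivity of \<open>R\<close> and \<open>P\<close> lifts \<open>s\<close> and
  \<open>r\<close> to the middle terms, and the lifts restrict to the kernels. The combination
  \<open>?x\<close> induces the identity on \<open>A\<close>, so it differs from the identity of
  \<open>R\<close> by some \<open>l \<cdot> t\<close>; on \<open>L\<close> this leaves
  \<open>r' \<cdot> s'\<close> and a term through \<open>R\<close>. For the second claim,
  \<open>g\<close> is the sum of \<open>g \<cdot> r' \<cdot> s'\<close>, which extends by way of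
  \<open>k\<close>, and \<open>g \<cdot> t \<cdot> l\<close>, which visibly extends.\<close>

lemma stable_retract_kernel:
  assumes "short_exact C L l R q A" "short_exact C K k P p B" "projective C R" "projective C P"
    and "stable_retract C A B"
  shows "stable_retract C L K" "left_proj_approx C k \<Longrightarrow> left_proj_approx C l"
proof -
  note S = short_exactD[OF assms(1)] and T = short_exactD[OF assms(2)]
  obtain s r Q u v where a: "s \<in> Hom C A B" "r \<in> Hom C B A" "projective C Q" "u \<in> Hom C A Q" "v \<in> Hom C Q A"
    "Ide C A = Add C (r \<cdot> s) (v \<cdot> u)" using assms(5) by (rule stable_retractE)
  have "s \<cdot> q \<in> Hom C R B" using a S by (simp add: in_Hom)
  then obtain \<sigma> where \<sigma>: "\<sigma> \<in> Hom C R P" "p \<cdot> \<sigma> = s \<cdot> q" using projective_lift[OF assms(3) T(5,2)] by blast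
  have "r \<cdot> p \<in> Hom C P A" using a T by (simp add: in_Hom)
  then obtain \<rho> where \<rho>: "\<rho> \<in> Hom C P R" "q \<cdot> \<rho> = r \<cdot> p" using projective_lift[OF assms(4) S(5,2)] by blast
  obtain w where w: "w \<in> Hom C Q R" "q \<cdot> w = v" using projective_lift[OF a(3) S(5,2) a(5)] .
  let ?x = "Add C (\<rho> \<cdot> \<sigma>) (w \<cdot> (u \<cdot> q))"
  have "q \<cdot> ?x = Add C (r \<cdot> s) (v \<cdot> u) \<cdot> q"
    using a(1-5) S(1,2) T(1,2) \<sigma> \<rho> w pre_comp[OF \<rho>(2), of \<sigma>] pre_comp[OF w(2), of "u \<cdot> q"]
    by (simp add: in_Hom)
  also have "\<dots> = q \<cdot> Ide C R" using S a(6)[symmetric] by (simp add: in_Hom)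
  finally have "q \<cdot> Ide C R = q \<cdot> ?x" by simp
  moreover have "Ide C R \<in> Hom C R R" "?x \<in> Hom C R R"
    using a S T \<sigma> \<rho> w assms(3) by (simp_all add: in_Hom)
  ultimately obtain t where t: "t \<in> Hom C R L" "Ide C R = Add C ?x (l \<cdot> t)"
    using short_exact_lift_difference[OF assms(1)] by metis
  have "\<sigma> \<cdot> l \<in> Hom C L P" "p \<cdot> (\<sigma> \<cdot> l) = Zero C L B"
    using S(1-3,8) T(2) a(1) \<sigma> pre_comp[OF \<sigma>(2), of l] by (simp_all add: in_Hom)
  then obtain s' where s': "s' \<in> Hom C L K" "k \<cdot> s' = \<sigma> \<cdot> l" by (rule short_exact_lift[OF assms(2)])
  have "\<rho> \<cdot> k \<in> Hom C K R" "q \<cdot> (\<rho> \<cdot> k) = Zero C K A"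
    using T(1-3,8) S(2) a(2) \<rho> pre_comp[OF \<rho>(2), of k] by (simp_all add: in_Hom)
  then obtain r' where r': "r' \<in> Hom C K L" "l \<cdot> r' = \<rho> \<cdot> k" by (rule short_exact_lift[OF assms(1)])
  have "l \<cdot> Add C (r' \<cdot> s') (t \<cdot> l) = Add C ?x (l \<cdot> t) \<cdot> l"
    using S(1-3,8-10) T(1) a(1-5) \<sigma>(1) \<rho>(1) w(1) t(1) s' r' pre_comp[OF r'(2), of s']
    by (simp add: in_Hom)
  also have "\<dots> = l \<cdot> Ide C L" using S t(2)[symmetric] by (simp add: in_Hom)
  finally have I: "Add C (r' \<cdot> s') (t \<cdot> l) = Ide C L"
    by (rule mono_arr_cancel[OF S(4)]) (use S s' r' t in \<open>simp_all add: in_Hom\<close>)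
  show "stable_retract C L K"
    by (rule stable_retractI[OF s'(1) r'(1) assms(3) S(1) t(1) I[symmetric]])
  assume k: "left_proj_approx C k"
  show "left_proj_approx C l"
  proof (rule left_proj_approxI[OF S(1) assms(3)])
    fix Q' g assume Q': "projective C Q'" and g: "g \<in> Hom C L Q'"
    have "g \<cdot> r' \<in> Hom C K Q'" using g r' by (simp add: in_Hom)
    from left_proj_approx_extend[OF k T(1) Q' this]
    obtain h where h: "h \<in> Hom C P Q'" "h \<cdot> k = g \<cdot> r'" .
    have "h \<cdot> (\<sigma> \<cdot> l) = g \<cdot> (r' \<cdot> s')"
      using s' T(1) h(1) r' g pre_comp[OF h(2), of s'] by (simp add: in_Hom)
    then have "Add C (h \<cdot> \<sigma>) (g \<cdot> t) \<cdot> l = g \<cdot> Add C (r' \<cdot> s') (t \<cdot> l)"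
      using s'(1) r'(1) S(1) T(1) h(1) g \<sigma>(1) t(1) by (simp add: in_Hom)
    also have "\<dots> = g" using g by (simp add: I in_Hom)
    finally show "\<exists>h\<in>Hom C R Q'. h \<cdot> l = g"
      using h \<sigma> g t by (intro bexI[of _ "Add C (h \<cdot> \<sigma>) (g \<cdot> t)"]) (simp_all add: in_Hom)
  qed
qed

text \<open>Dual to \<open>stable_retract_kernel\<close>, with the approximation property in the
  place of injectivity: \<open>P\<close>, \<open>R\<close> and \<open>Q\<close> are projective, so
  maps from \<open>L\<close> or \<open>K\<close> into them extend. This undoes the passage to
  syzygies.\<close>

lemma stable_retract_cokernel:
  assumes "short_exact C L l R q A" "short_exact C K k P p B" "left_proj_approx C l" "left_proj_approx C k"
    and "stable_retract C L K"
  shows "stable_retract C A B"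
proof -
  note S = short_exactD[OF assms(1)] and T = short_exactD[OF assms(2)]
  have R: "projective C R" and P: "projective C P"
    using left_proj_approx_projective assms(3,4) S(1) T(1) by blast+
  obtain s r Q u v where a: "s \<in> Hom C L K" "r \<in> Hom C K L" "projective C Q" "u \<in> Hom C L Q" "v \<in> Hom C Q L"
    "Ide C L = Add C (r \<cdot> s) (v \<cdot> u)" using assms(5) by (rule stable_retractE)
  have "k \<cdot> s \<in> Hom C L P" using a T by (simp add: in_Hom)
  then obtain \<sigma> where \<sigma>: "\<sigma> \<in> Hom C R P" "\<sigma> \<cdot> l = k \<cdot> s"
    using left_proj_approx_extend[OF assms(3) S(1) P] by blast
  have "l \<cdot> r \<in> Hom C K R" using a S by (simp add: in_Hom)
  then obtain \<rho> where \<rho>: "\<rho> \<in> Hom C P R" "\<rho> \<cdot> k = l \<cdot> r"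
    using left_proj_approx_extend[OF assms(4) T(1) R] by blast
  obtain w where w: "w \<in> Hom C R Q" "w \<cdot> l = u" using left_proj_approx_extend[OF assms(3) S(1) a(3,4)] .
  let ?x = "Add C (\<rho> \<cdot> \<sigma>) (l \<cdot> (v \<cdot> w))"
  have "?x \<cdot> l = l \<cdot> Add C (r \<cdot> s) (v \<cdot> u)"
    using a(1-5) S(1,2) T(1,2) \<sigma> \<rho> w pre_comp[OF \<rho>(2), of s] by (simp add: in_Hom)
  also have "\<dots> = Ide C R \<cdot> l" using S a(6)[symmetric] by (simp add: in_Hom)
  finally have "Ide C R \<cdot> l = ?x \<cdot> l" by simp
  moreover have "Ide C R \<in> Hom C R R" "?x \<in> Hom C R R"
    using a S T \<sigma> \<rho> w R by (simp_all add: in_Hom)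
  ultimately obtain t where t: "t \<in> Hom C A R" "Ide C R = Add C ?x (t \<cdot> q)"
    using short_exact_colift_difference[OF assms(1)] by metis
  have "p \<cdot> \<sigma> \<in> Hom C R B" "(p \<cdot> \<sigma>) \<cdot> l = Zero C L B"
    using S(1) T(1-3,10) a(1) \<sigma> pre_comp[OF T(3), of s] by (simp_all add: in_Hom)
  then obtain s' where s': "s' \<in> Hom C A B" "s' \<cdot> q = p \<cdot> \<sigma>" by (rule short_exact_colift[OF assms(1)])
  have "q \<cdot> \<rho> \<in> Hom C P A" "(q \<cdot> \<rho>) \<cdot> k = Zero C K A"
    using T(1) S(1-3,10) a(2) \<rho> pre_comp[OF S(3), of r] by (simp_all add: in_Hom)
  then obtain r' where r': "r' \<in> Hom C B A" "r' \<cdot> p = q \<cdot> \<rho>" by (rule short_exact_colift[OF assms(2)])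
  have "Add C (r' \<cdot> s') (q \<cdot> t) \<cdot> q = q \<cdot> Add C ?x (t \<cdot> q)"
    using S(1-3,8-10) T(1,2) a(1-5) \<sigma>(1) \<rho>(1) w(1) t(1) s' r' pre_comp[OF r'(2), of \<sigma>]
      pre_comp[OF S(3), of "v \<cdot> w"]
    by (simp add: in_Hom)
  also have "\<dots> = Ide C A \<cdot> q" using S t(2)[symmetric] by (simp add: in_Hom)
  finally have I: "Add C (r' \<cdot> s') (q \<cdot> t) = Ide C A"
    by (rule epi_arr_cancel[OF S(5)]) (use S s' r' t in \<open>simp_all add: in_Hom\<close>)
  show ?thesis
    by (rule stable_retractI[OF s'(1) r'(1) R t(1) S(2) I[symmetric]])
qed

text \<open>If \<open>k\<close> is a mono left approximation of \<open>B\<close> and \<open>Ide A\<close> is \<open>r \<cdot> s\<close> plus a morphism factoring as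
  \<open>v \<cdot> u\<close>, then \<open>(k \<cdot> s, u)\<close> is one of \<open>A\<close>.\<close>

lemma stable_retract_mono_approx:
  assumes "stable_retract C A B" "mono_arr C k" "k \<in> Hom C B P" "left_proj_approx C k"
  obtains l R where "l \<in> Hom C A R" "mono_arr C l" "left_proj_approx C l"
proof -
  obtain s r Q u v where a: "s \<in> Hom C A B" "r \<in> Hom C B A" "projective C Q" "u \<in> Hom C A Q" "v \<in> Hom C Q A"
    "Ide C A = Add C (r \<cdot> s) (v \<cdot> u)" using assms(1) by (rule stable_retractE)
  have ks: "k \<cdot> s \<in> Hom C A P" using a assms by (simp add: in_Hom)
  obtain R l p q where R: "projective C R" "l \<in> Hom C A R" "p \<in> Hom C R P" "q \<in> Hom C R Q" "p \<cdot> l = k \<cdot> s" "q \<cdot> l = u"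
    using ex_projective_pairing[OF left_proj_approx_projective[OF assms(4,3)] a(3) ks a(4)] .
  have "mono_arr C l"
  proof (rule mono_arrI[OF R(2)])
    fix Z x assume x: "x \<in> Hom C Z A" "l \<cdot> x = Zero C Z R"
    have Z: "Z \<in> Ob C" "A \<in> Ob C" "B \<in> Ob C" "Q \<in> Ob C" using x a(1,4) by (auto simp: in_Hom)
    have "k \<cdot> (s \<cdot> x) = Zero C Z P"
      using pre_comp[OF R(5), of x] x Z R(2,3) a(1) assms(3) by (simp add: in_Hom)
    then have "s \<cdot> x = Zero C Z B"
      by (rule mono_arr_zero[OF assms(2,3), rotated]) (use x a in \<open>simp add: in_Hom\<close>)
    moreover have "u \<cdot> x = Zero C Z Q"
      using pre_comp[OF R(6), of x] x Z R(2,4) a(4) by (simp add: in_Hom)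
    moreover have "x = Add C (r \<cdot> (s \<cdot> x)) (v \<cdot> (u \<cdot> x))"
    proof -
      have "x = Add C (r \<cdot> s) (v \<cdot> u) \<cdot> x" using x(1) a(6)[symmetric] by (simp add: in_Hom)
      then show ?thesis using x(1) a(1-5) by (simp add: in_Hom)
    qed
    ultimately show "x = Zero C Z A" using x(1) Z a(1-5) by (simp add: in_Hom)
  qed
  moreover have "left_proj_approx C l"
  proof (rule left_proj_approxI[OF R(2,1)])
    fix Q' g assume Q': "projective C Q'" and g: "g \<in> Hom C A Q'"
    have "g \<cdot> r \<in> Hom C B Q'" using g a by (simp add: in_Hom)
    from left_proj_approx_extend[OF assms(4,3) Q' this]
    obtain h where h: "h \<in> Hom C P Q'" "h \<cdot> k = g \<cdot> r" .
    have "Add C (h \<cdot> p) (g \<cdot> (v \<cdot> q)) \<cdot> l = g \<cdot> Add C (r \<cdot> s) (v \<cdot> u)"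
      using h a(1-5) R g assms(3) pre_comp[OF h(2), of s] by (simp add: in_Hom)
    also have "\<dots> = g" using g by (simp add: a(6)[symmetric] in_Hom)
    finally show "\<exists>h\<in>Hom C R Q'. h \<cdot> l = g"
      using h R g a by (intro bexI[of _ "Add C (h \<cdot> p) (g \<cdot> (v \<cdot> q))"]) (simp_all add: in_Hom)
  qed
  ultimately show ?thesis using that R by blast
qed

end

section \<open>Syzygies\<close>

text \<open>An Ext-free description of \<open>\<^sup>\<bottom>P\<close>: some projective resolution of \<open>X\<close> consists of left
  approximations \<open>K \<rightarrow> P\<close>. It does not depend on the resolution.\<close>

coinductive proj_orthogonal :: "('o, 'm, 'z) cat_scheme \<Rightarrow> 'o \<Rightarrow> bool"
  for C :: "('o, 'm, 'z) cat_scheme"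
  where proj_orthogonalI:
    "\<lbrakk>short_exact C K k P p X; left_proj_approx C k; proj_orthogonal C K\<rbrakk> \<Longrightarrow> proj_orthogonal C X"

text \<open>\<open>torsionfree\<close> cut into short exact sequences. The recursion passes to the
  cokernel \<open>Y\<close>, which is the form that induction along stable retracts can use.\<close>

primrec approx_coresolvable :: "('o, 'm, 'z) cat_scheme \<Rightarrow> nat \<Rightarrow> 'o \<Rightarrow> bool" where
  "approx_coresolvable C 0 X \<longleftrightarrow> True"
| "approx_coresolvable C (Suc n) X \<longleftrightarrow> (\<exists>k P p Y. short_exact C X k P p Y \<and> left_proj_approx C k \<and>
     approx_coresolvable C n Y)"

lemma (in category) epi_arr_Ide: "X \<in> Ob C \<Longrightarrow> epi_arr C (Ide C X)"
  unfolding epi_arr_def by (auto simp: in_Hom)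

lemma approx_coresolvable_antimono:
  "approx_coresolvable C n X \<Longrightarrow> m \<le> n \<Longrightarrow> approx_coresolvable C m X"
proof (induction n arbitrary: X m)
  case (Suc n)
  show ?case
  proof (cases m)
    case (Suc m')
    have "approx_coresolvable C n Y \<Longrightarrow> approx_coresolvable C m' Y" for Y
      using Suc.IH[of Y m'] Suc.prems(2) Suc by simp
    then show ?thesis using Suc.prems(1) Suc by fastforce
  qed simp
qed simp

lemma approx_coresolvable_seq:
  assumes "approx_coresolvable C n X"
  shows "\<exists>Z k P p. Z 0 = X \<and>
    (\<forall>i<n. short_exact C (Z i) (k i) (P i) (p i) (Z (Suc i)) \<and> left_proj_approx C (k i))"
  using assms
proof (induction n arbitrary: X)
  case 0
  show ?case by (rule exI[of _ "\<lambda>_. X"]) simp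
next
  case (Suc n)
  then obtain k0 P0 p0 Y where Y: "short_exact C X k0 P0 p0 Y" "left_proj_approx C k0" "approx_coresolvable C n Y"
    by auto
  from Suc.IH[OF Y(3)] obtain Z k P p where Z: "Z 0 = Y"
    "\<forall>i<n. short_exact C (Z i) (k i) (P i) (p i) (Z (Suc i)) \<and> left_proj_approx C (k i)" by blast
  have "short_exact C (case_nat X Z i) (case_nat k0 k i) (case_nat P0 P i) (case_nat p0 p i) (case_nat X Z (Suc i))
    \<and> left_proj_approx C (case_nat k0 k i)" if "i < Suc n" for i
    using that Y Z by (cases i) auto
  then show ?case by (intro exI[of _ "case_nat X Z"] exI[of _ "case_nat k0 k"] exI[of _ "case_nat P0 P"]
    exI[of _ "case_nat p0 p"]) simp
qed

section \<open>Finite coresolutions by left approximations\<close>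

context abelian_category
begin

text \<open>The retract has a mono approximation of its own, and by
  \<open>stable_retract_cokernel\<close> the cokernel of that is a stable retract of
  \<open>Y\<close>, to which the induction applies.\<close>

lemma approx_coresolvable_stable_retract:
  "approx_coresolvable C n B \<Longrightarrow> stable_retract C A B \<Longrightarrow> approx_coresolvable C n A"
proof (induction n arbitrary: A B)
  case (Suc n)
  then obtain k P p Y where Y: "short_exact C B k P p Y" "left_proj_approx C k" "approx_coresolvable C n Y"
    by auto
  note S = short_exactD[OF Y(1)]
  obtain l R where l: "l \<in> Hom C A R" "mono_arr C l" "left_proj_approx C l"
    using stable_retract_mono_approx[OF Suc.prems(2) S(4,1) Y(2)] .
  obtain q Y' where q: "short_exact C A l R q Y'" using ex_mono_short_exact[OF l(2,1)] .
  have "stable_retract C Y' Y" by (rule stable_retract_cokernel[OF q Y(1) l(3) Y(2) Suc.prems(2)])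
  from Suc.IH[OF Y(3) this] q l(3) show ?case by auto
qed simp

lemma approx_coresolvable_torsionfree:
  assumes "approx_coresolvable C n X" "n \<ge> 1"
  shows "X \<in> torsionfree C n"
proof -
  obtain Z k P p where Z: "Z 0 = X"
    "\<And>i. i < n \<Longrightarrow> short_exact C (Z i) (k i) (P i) (p i) (Z (Suc i)) \<and> left_proj_approx C (k i)"
    using approx_coresolvable_seq[OF assms(1)] by blast
  note S = short_exactD[OF conjunct1[OF Z(2)]]
  have X: "X \<in> Ob C" using S(8)[of 0] assms(2) Z(1) by simp
  \<comment> \<open>The maps of \<open>torsionfree\<close> are numbered from 1 and start at
    \<open>P 0 = X\<close>, while \<open>Z\<close>, \<open>k\<close>, \<open>p\<close> are numbered
    from 0. With the identity as \<open>q 0\<close>, the first map fits the splicing formula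
    \<open>f (Suc i) = k i \<cdot> q i\<close>.\<close>
  define P' where "P' = case_nat X P"
  define q where "q = case_nat (Ide C X) p"
  define f where "f i = k (i - 1) \<cdot> q (i - 1)" for i
  have q: "q i \<in> Hom C (P' i) (Z i) \<and> epi_arr C (q i)" if "i < n" for i
    using that X S(2,5)[of "i - 1"] Z(1) by (cases i) (auto simp: q_def P'_def in_Hom epi_arr_Ide)
  have kt: "k i \<in> Hom C (Z i) (P' (Suc i))" if "i < n" for i
    using S(1)[OF that] by (simp add: P'_def)
  have proj: "projective C (P' (Suc i))" if "i < n" for i
    using left_proj_approx_projective[OF _ kt] Z(2) that by blast
  have ft: "f (Suc i) \<in> Hom C (P' i) (P' (Suc i))" if "i < n" for i
    using q[OF that] kt[OF that] by (simp add: f_def in_Hom)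
  have "P' 0 = X" by (simp add: P'_def)
  moreover have "\<forall>i\<in>{1..n}. projective C (P' i) \<and> f i \<in> Hom C (P' (i - 1)) (P' i)"
  proof
    fix i assume "i \<in> {1..n}"
    then have "i - 1 < n" "Suc (i - 1) = i" by auto
    then show "projective C (P' i) \<and> f i \<in> Hom C (P' (i - 1)) (P' i)"
      using proj[of "i - 1"] ft[of "i - 1"] by simp
  qed
  moreover have "mono_arr C (f 1)"
    using S(1,4)[of 0] assms(2) Z(1) by (simp add: f_def q_def in_Hom)
  moreover have "\<forall>i\<in>{1..<n}. exact_at C (f i) (f (i + 1))"
  proof
    fix i assume i: "i \<in> {1..<n}"
    define j where "j = i - 1"
    have j: "i = Suc j" "Suc j < n" using i by (auto simp: j_def)
    have "is_kernel C (k (Suc j) \<cdot> q (Suc j)) (k j)"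
      using is_kernel_mono_Comp[OF S(4,1)[OF j(2)] S(2)[of j]] S(6)[of j] j(2) by (simp add: q_def)
    then have "exact_at C (k j \<cdot> q j) (f (Suc (Suc j)))"
      by (subst exact_at_iff[where X = "P' j" and I = "Z j" and Y = "P j" and Z = "P (Suc j)"])
        (use j S(1,4) q ft[of "Suc j"] in \<open>auto simp: f_def P'_def\<close>)
    then show "exact_at C (f i) (f (i + 1))" by (simp add: j(1) f_def)
  qed
  moreover have "\<forall>i\<in>{1..n}. \<forall>m. is_image C (f i) m \<longrightarrow> left_proj_approx C m"
  proof (intro ballI allI impI)
    fix i m assume i: "i \<in> {1..n}" and m: "is_image C (f i) m"
    define j where "j = i - 1"
    have j: "j < n" "f i = k j \<cdot> q j" using i by (auto simp: j_def f_def)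
    obtain u v where u: "u \<in> Hom C (Dom C m) (Z j)" "v \<in> Hom C (Z j) (Dom C m)" "k j \<cdot> u = m"
      "m \<cdot> v = k j" "mono_arr C m" "m \<in> Hom C (Dom C m) (P' (Suc j))" "v \<cdot> u = Ide C (Dom C m)"
      using is_image_mono_retract[OF _ _ S(4)[OF j(1)] kt[OF j(1)] m[unfolded j(2)]] q[OF j(1)] by blast
    show "left_proj_approx C m"
    proof (rule left_proj_approxI[OF u(6) proj[OF j(1)]])
      fix Q g assume Q: "projective C Q" and g: "g \<in> Hom C (Dom C m) Q"
      have "g \<cdot> v \<in> Hom C (Z j) Q" using g u by (simp add: in_Hom)
      from left_proj_approx_extend[OF conjunct2[OF Z(2)[OF j(1)]] kt[OF j(1)] Q this]
      obtain h where h: "h \<in> Hom C (P' (Suc j)) Q" "h \<cdot> k j = g \<cdot> v" .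
      have "h \<cdot> m = (h \<cdot> k j) \<cdot> u" using h(1) kt[OF j(1)] u(1,3) by (simp add: in_Hom)
      also have "\<dots> = g" using u(1,2,7) g unfolding h(2) by (simp add: in_Hom)
      finally show "\<exists>h\<in>Hom C (P' (Suc j)) Q. h \<cdot> m = g" using h(1) by blast
    qed
  qed
  ultimately show ?thesis unfolding torsionfree_def using X by blast
qed

lemma stable_retract_projective:
  assumes "stable_retract C A B" "projective C B"
  shows "projective C A"
proof -
  obtain s r Q u v where a: "s \<in> Hom C A B" "r \<in> Hom C B A" "projective C Q" "u \<in> Hom C A Q" "v \<in> Hom C Q A"
    "Ide C A = Add C (r \<cdot> s) (v \<cdot> u)" using assms(1) by (rule stable_retractE)
  obtain R h p q where R: "projective C R" "h \<in> Hom C A R" "p \<in> Hom C R B" "q \<in> Hom C R Q" "p \<cdot> h = s" "q \<cdot> h = u"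
    using ex_projective_pairing[OF assms(2) a(3) a(1) a(4)] .
  have "Add C (r \<cdot> p) (v \<cdot> q) \<cdot> h = Ide C A"
    using a(1-5) R a(6)[symmetric] by (simp add: in_Hom)
  then show ?thesis
    by (rule projective_retract[OF R(1,2), rotated]) (use a R in \<open>simp add: in_Hom\<close>)
qed

text \<open>Extending the identity of \<open>K\<close> along \<open>k\<close> splits the sequence,
  so \<open>X\<close> is a retract of \<open>P\<close>. Used contrapositively: a nonprojective
  object of \<open>\<^sup>\<bottom>P\<close> has a nonprojective syzygy.\<close>

lemma projective_cokernel:
  assumes "short_exact C K k P p X" "left_proj_approx C k" "projective C K"
  shows "projective C X"
proof -
  note S = short_exactD[OF assms(1)]
  have P: "projective C P" by (rule left_proj_approx_projective[OF assms(2) S(1)])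
  have "Ide C K \<in> Hom C K K" using S(8) by (simp add: in_Hom)
  from left_proj_approx_extend[OF assms(2) S(1) assms(3) this]
  obtain h where h: "h \<in> Hom C P K" "h \<cdot> k = Ide C K" .
  have "Ide C P \<cdot> k = (k \<cdot> h) \<cdot> k" using h S(1,8,9) by (simp add: in_Hom)
  moreover have "Ide C P \<in> Hom C P P" "k \<cdot> h \<in> Hom C P P" using h S(1,9) by (simp_all add: in_Hom)
  ultimately obtain w where w: "w \<in> Hom C X P" "Ide C P = Add C (k \<cdot> h) (w \<cdot> p)"
    using short_exact_colift_difference[OF assms(1)] by metis
  have "(p \<cdot> w) \<cdot> p = p \<cdot> Add C (k \<cdot> h) (w \<cdot> p)"
    using w(1) h(1) S(1,2,8-10) pre_comp[OF S(3), of h] by (simp add: in_Hom)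
  also have "\<dots> = Ide C X \<cdot> p" using S(2,9,10) w(2)[symmetric] by (simp add: in_Hom)
  finally have "p \<cdot> w = Ide C X"
    by (rule epi_arr_cancel[OF S(5)]) (use S w in \<open>simp_all add: in_Hom\<close>)
  with projective_retract[OF P w(1) S(2)] show ?thesis .
qed

end

section \<open>Invariance of \<open>proj_orthogonal\<close> under stable retracts\<close>

locale abelian_enough_projectives = abelian_category +
  assumes enough: "enough_projectives C"
begin

lemma ex_presentation:
  assumes "X \<in> Ob C"
  obtains K k P p where "short_exact C K k P p X" "projective C P"
proof -
  obtain P p where P: "projective C P" "p \<in> Hom C P X" "epi_arr C p"
    using enough assms unfolding enough_projectives_def by blast
  obtain K k where "short_exact C K k P p X" using ex_epi_short_exact[OF P(3,2)] .
  then show ?thesis using that P(1) by blast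
qed

lemma retract_stable_retract:
  assumes "s \<in> Hom C A B" "r \<in> Hom C B A" "r \<cdot> s = Ide C A"
  shows "stable_retract C A B"
proof -
  have A: "A \<in> Ob C" using assms(1) by (auto simp: in_Hom)
  then obtain Q where Q: "projective C Q" using enough unfolding enough_projectives_def by blast
  show ?thesis
    by (rule stable_retractI[OF assms(1,2) Q, of "Zero C A Q" "Zero C Q A"])
      (use assms(3) A Q in \<open>simp_all add: in_Hom\<close>)
qed

lemma stable_retract_refl: "X \<in> Ob C \<Longrightarrow> stable_retract C X X"
  by (rule retract_stable_retract[of "Ide C X" _ _ "Ide C X"]) (simp_all add: in_Hom)

lemma iso_stable_retract: "(X, Y) \<in> iso_rel C \<Longrightarrow> stable_retract C X Y"
  unfolding iso_rel_def by (auto intro: retract_stable_retract)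

text \<open>One step of the coinduction for \<open>proj_orthogonal_stable_retract\<close>: the class
  of stable retracts of orthogonal objects is closed under syzygies, whence the existential in the
  conclusion.\<close>

lemma proj_orthogonal_stable_kernel:
  assumes "proj_orthogonal C B" "stable_retract C A B" "short_exact C L l R q A" "projective C R"
  shows "left_proj_approx C l \<and> (\<exists>K. proj_orthogonal C K \<and> stable_retract C L K)"
proof -
  from assms(1) obtain K k P p where K: "short_exact C K k P p B" "left_proj_approx C k" "proj_orthogonal C K"
    by (blast elim: proj_orthogonal.cases)
  have "projective C P" by (rule left_proj_approx_projective[OF K(2) short_exactD(1)[OF K(1)]])
  from stable_retract_kernel[OF assms(3) K(1) assms(4) this assms(2)] K show ?thesis by blast
qed

lemma stable_retract_Ob:
  assumes "stable_retract C A B"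
  shows "A \<in> Ob C" "B \<in> Ob C"
  using assms unfolding stable_retract_def by (auto simp: in_Hom)

lemma proj_orthogonal_stable_retract:
  assumes "proj_orthogonal C B" "stable_retract C A B"
  shows "proj_orthogonal C A"
proof -
  have "\<exists>B. proj_orthogonal C B \<and> stable_retract C A B" using assms by blast
  then show ?thesis
  proof (coinduction arbitrary: A rule: proj_orthogonal.coinduct)
    case (proj_orthogonal A)
    then obtain B where B: "proj_orthogonal C B" "stable_retract C A B" by blast
    obtain L l R q where L: "short_exact C L l R q A" "projective C R"
      using ex_presentation[OF stable_retract_Ob(1)[OF B(2)]] .
    show ?case using proj_orthogonal_stable_kernel[OF B L] L(1) by blast
  qed
qed

lemma proj_orthogonal_Ob: "proj_orthogonal C X \<Longrightarrow> X \<in> Ob C"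
  by (erule proj_orthogonal.cases) (use short_exactD(10) in blast)

text \<open>Taking \<open>X\<close> as a stable retract of itself covers every presentation by a
  projective, not only the one that witnesses \<open>proj_orthogonal C X\<close>. This is the
  independence of the resolution.\<close>

lemma proj_orthogonal_kernel:
  assumes "proj_orthogonal C X" "short_exact C K k P p X" "projective C P"
  shows "left_proj_approx C k" "proj_orthogonal C K"
  using proj_orthogonal_stable_kernel[OF assms(1) stable_retract_refl[OF proj_orthogonal_Ob[OF assms(1)]] assms(2,3)]
    proj_orthogonal_stable_retract by blast+

end

section \<open>Objects with local endomorphism rings\<close>

context abelian_category
begin

lemma Units_end_ring:
  "a \<in> Units (end_ring C X) \<longleftrightarrow>
     a \<in> Hom C X X \<and> (\<exists>b \<in> Hom C X X. b \<cdot> a = Ide C X \<and> a \<cdot> b = Ide C X)"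
  by (auto simp: Units_def end_ring_def)

text \<open>The empty sum is a nonunit because the ring is nonzero; in the application this rules
  out a syzygy without any summand.\<close>

lemma local_ring_finprod:
  assumes "local_ring (end_ring C X)" "X \<in> Ob C" "finite I"
    "\<And>i. i \<in> I \<Longrightarrow> f i \<in> Hom C X X" "\<And>i. i \<in> I \<Longrightarrow> f i \<notin> Units (end_ring C X)"
  shows "finprod (hom_group C X X) f I \<notin> Units (end_ring C X)"
  using assms(3-5)
proof (induction I)
  case empty
  have "Ide C X \<noteq> Zero C X X" using assms(1) by (simp add: local_ring_def end_ring_def)
  then show ?case using assms(2) by (auto simp: Units_end_ring in_Hom)
next
  case (insert i I)
  have "f i \<in> carrier (end_ring C X) - Units (end_ring C X)"
    using insert by (simp add: end_ring_def)
  moreover have "finprod (hom_group C X X) f I \<in> carrier (end_ring C X) - Units (end_ring C X)"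
    using insert finprod_hom_group_closed[of I f X X] assms(2) by (simp add: end_ring_def)
  ultimately have "f i \<oplus>\<^bsub>end_ring C X\<^esub> finprod (hom_group C X X) f I \<notin> Units (end_ring C X)"
    using assms(1) unfolding local_ring_def by blast
  moreover have "finprod (hom_group C X X) f (insert i I) = f i \<oplus>\<^bsub>end_ring C X\<^esub> finprod (hom_group C X X) f I"
    using finprod_hom_group_insert[of I i f X X] insert by (simp add: end_ring_def)
  ultimately show ?case by simp
qed

lemma direct_sumD:
  assumes "is_direct_sum C n Y X \<iota> \<pi>"
  shows "X \<in> Ob C" "i < n \<Longrightarrow> \<iota> i \<in> Hom C (Y i) X" "i < n \<Longrightarrow> \<pi> i \<in> Hom C X (Y i)"
    "i < n \<Longrightarrow> \<pi> i \<cdot> \<iota> i = Ide C (Y i)" "finprod (hom_group C X X) (\<lambda>i. \<iota> i \<cdot> \<pi> i) {..<n} = Ide C X"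
  using assms by (simp_all add: is_direct_sum_def)

end

context abelian_enough_projectives
begin

lemma direct_summand_stable_retract:
  assumes "is_direct_sum C n Y X \<iota> \<pi>" "i < n"
  shows "stable_retract C (Y i) X"
  by (rule retract_stable_retract[OF direct_sumD(2,3,4)[OF assms]])

text \<open>Endomorphisms of \<open>K\<close> extend to \<open>P\<close> and induce endomorphisms of \<open>X\<close>. Those induced by the
  projections onto the summands of \<open>K\<close> add up to the identity modulo projectives, so one of them
  is a unit of the local ring.\<close>

lemma stable_syzygy_summand:
  assumes "short_exact C K k P p X" "left_proj_approx C k" "local_ring (end_ring C X)" "\<not> projective C X"
    and "is_direct_sum C n Y K \<iota> \<pi>"
  obtains j where "j < n" "stable_retract C K (Y j)"
proof -
  note S = short_exactD[OF assms(1)] and D = direct_sumD[OF assms(5)]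
  have P: "projective C P" by (rule left_proj_approx_projective[OF assms(2) S(1)])
  have "\<exists>\<sigma> a. \<sigma> \<in> Hom C P P \<and> a \<in> Hom C X X \<and> \<sigma> \<cdot> k = k \<cdot> (\<iota> j \<cdot> \<pi> j) \<and> a \<cdot> p = p \<cdot> \<sigma>" if "j < n" for j
  proof -
    have "k \<cdot> (\<iota> j \<cdot> \<pi> j) \<in> Hom C K P" using S(1) D(2,3)[OF that] by (simp add: in_Hom)
    from left_proj_approx_extend[OF assms(2) S(1) P this]
    obtain \<sigma> where \<sigma>: "\<sigma> \<in> Hom C P P" "\<sigma> \<cdot> k = k \<cdot> (\<iota> j \<cdot> \<pi> j)" .
    have "p \<cdot> \<sigma> \<in> Hom C P X" "(p \<cdot> \<sigma>) \<cdot> k = Zero C K X"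
      using \<sigma> S(1-3,8-10) D(2,3)[OF that] pre_comp[OF S(3), of "\<iota> j \<cdot> \<pi> j"] by (simp_all add: in_Hom)
    then obtain a where "a \<in> Hom C X X" "a \<cdot> p = p \<cdot> \<sigma>" by (rule short_exact_colift[OF assms(1)])
    with \<sigma> show ?thesis by blast
  qed
  then obtain \<sigma> a where \<sigma>: "\<And>j. j < n \<Longrightarrow> \<sigma> j \<in> Hom C P P" "\<And>j. j < n \<Longrightarrow> \<sigma> j \<cdot> k = k \<cdot> (\<iota> j \<cdot> \<pi> j)"
    and a: "\<And>j. j < n \<Longrightarrow> a j \<in> Hom C X X" "\<And>j. j < n \<Longrightarrow> a j \<cdot> p = p \<cdot> \<sigma> j"
    by metis
  define \<Sigma> where "\<Sigma> = finprod (hom_group C P P) \<sigma> {..<n}"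
  define A where "A = finprod (hom_group C X X) a {..<n}"
  have \<Sigma>: "\<Sigma> \<in> Hom C P P" unfolding \<Sigma>_def
    by (rule finprod_hom_group_closed) (use \<sigma> S in auto)
  have A: "A \<in> Hom C X X" unfolding A_def
    by (rule finprod_hom_group_closed) (use a S in auto)
  have kD: "k \<cdot> (\<iota> j \<cdot> \<pi> j) \<in> Hom C K P" if "j < n" for j
    using S(1) D(2,3)[OF that] by (simp add: in_Hom)
  have "\<Sigma> \<cdot> k = finprod (hom_group C K P) (\<lambda>j. \<sigma> j \<cdot> k) {..<n}" unfolding \<Sigma>_def
    by (rule finprod_Comp) (use \<sigma> S in auto)
  also have "\<dots> = finprod (hom_group C K P) (\<lambda>j. k \<cdot> (\<iota> j \<cdot> \<pi> j)) {..<n}"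
    by (rule finprod_hom_group_cong) (use \<sigma> S kD in auto)
  also have "\<dots> = k \<cdot> finprod (hom_group C K K) (\<lambda>j. \<iota> j \<cdot> \<pi> j) {..<n}"
    by (rule Comp_finprod[symmetric]) (use D(2,3) S in \<open>auto simp: in_Hom\<close>)
  also have "\<dots> = Ide C P \<cdot> k" using D(5) S(1,9) by (simp add: in_Hom)
  finally have "Ide C P \<cdot> k = \<Sigma> \<cdot> k" by simp
  moreover have "Ide C P \<in> Hom C P P" using S(9) by (simp add: in_Hom)
  \<comment> \<open>The sum \<open>\<Sigma>\<close> of the extensions agrees with the identity of
    \<open>P\<close> on \<open>K\<close>, so the two differ by a map through \<open>X\<close>. On
    \<open>X\<close>, the sum \<open>A\<close> of the induced maps is therefore the identity up to
    \<open>p \<cdot> w\<close>.\<close>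
  ultimately obtain w where w: "w \<in> Hom C X P" "Ide C P = Add C \<Sigma> (w \<cdot> p)"
    using short_exact_colift_difference[OF assms(1) _ \<Sigma>] by metis
  have "p \<cdot> \<Sigma> = finprod (hom_group C P X) (\<lambda>j. p \<cdot> \<sigma> j) {..<n}" unfolding \<Sigma>_def
    by (rule Comp_finprod) (use \<sigma> S in auto)
  also have "\<dots> = finprod (hom_group C P X) (\<lambda>j. a j \<cdot> p) {..<n}"
    by (rule finprod_hom_group_cong) (use a \<sigma>(1) S in \<open>auto simp: in_Hom\<close>)
  also have "\<dots> = A \<cdot> p" unfolding A_def
    by (rule finprod_Comp[symmetric]) (use a S in auto)
  finally have "Add C A (p \<cdot> w) \<cdot> p = p \<cdot> Add C \<Sigma> (w \<cdot> p)"
    using A w(1) \<Sigma> S(1,2) by (simp add: in_Hom)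
  also have "\<dots> = Ide C X \<cdot> p" using w(2)[symmetric] S(2,9) by (simp add: in_Hom)
  finally have one: "Add C A (p \<cdot> w) = Ide C X"
    by (rule epi_arr_cancel[OF S(5)]) (use A w S in \<open>simp_all add: in_Hom\<close>)
  have pw: "p \<cdot> w \<in> Hom C X X" using S w by (simp add: in_Hom)
  \<comment> \<open>If \<open>p \<cdot> w\<close> were invertible, \<open>X\<close> would be a
    retract of \<open>P\<close> and hence projective.\<close>
  have "p \<cdot> w \<notin> Units (end_ring C X)"
  proof
    assume "p \<cdot> w \<in> Units (end_ring C X)"
    then obtain x where "x \<in> Hom C X X" "(p \<cdot> w) \<cdot> x = Ide C X" by (auto simp: Units_end_ring)
    then have "w \<cdot> x \<in> Hom C X P" "p \<cdot> (w \<cdot> x) = Ide C X" using S(2) w(1) by (simp_all add: in_Hom)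
    with projective_retract[OF P _ S(2)] assms(4) show False by blast
  qed
  moreover have "A \<oplus>\<^bsub>end_ring C X\<^esub> (p \<cdot> w) \<in> Units (end_ring C X)"
    using one S(10) by (auto simp: end_ring_def[of C X] Units_def in_Hom intro!: bexI[of _ "Ide C X"])
  ultimately have "A \<in> Units (end_ring C X)"
    using assms(3) A pw unfolding local_ring_def by (auto simp: end_ring_def)
  then obtain j where j: "j < n" "a j \<in> Units (end_ring C X)"
    using local_ring_finprod[OF assms(3) S(10), of "{..<n}" a] a unfolding A_def by auto
  then obtain b where b: "b \<in> Hom C X X" "b \<cdot> a j = Ide C X" by (auto simp: Units_end_ring)
  \<comment> \<open>Back to \<open>K\<close>: the inverse \<open>b\<close> of \<open>a j\<close>
    lifts to \<open>\<tau>\<close> on \<open>P\<close>, which restricts to \<open>\<beta>\<close> on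
    \<open>K\<close>. Then \<open>\<beta> \<cdot> \<iota> j\<close> is the retraction for
    \<open>\<pi> j\<close>, with an error term through \<open>P\<close>.\<close>
  have "b \<cdot> p \<in> Hom C P X" using b S by (simp add: in_Hom)
  then obtain \<tau> where \<tau>: "\<tau> \<in> Hom C P P" "p \<cdot> \<tau> = b \<cdot> p" using projective_lift[OF P S(5,2)] by blast
  have "\<tau> \<cdot> k \<in> Hom C K P" "p \<cdot> (\<tau> \<cdot> k) = Zero C K X"
    using \<tau> b(1) S(1-3,8-10) pre_comp[OF \<tau>(2), of k] by (simp_all add: in_Hom)
  then obtain \<beta> where \<beta>: "\<beta> \<in> Hom C K K" "k \<cdot> \<beta> = \<tau> \<cdot> k" by (rule short_exact_lift[OF assms(1)])
  note \<sigma>j = \<sigma>[OF j(1)] and aj = a[OF j(1)] and Dj = D(2-4)[OF j(1)]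
  have "p \<cdot> (\<tau> \<cdot> \<sigma> j) = b \<cdot> (p \<cdot> \<sigma> j)"
    using pre_comp[OF \<tau>(2), of "\<sigma> j"] \<tau>(1) \<sigma>j(1) b(1) S(2) by (simp add: in_Hom)
  also have "\<dots> = (b \<cdot> a j) \<cdot> p" using aj b(1) S(2) by (simp add: in_Hom)
  also have "\<dots> = p \<cdot> Ide C P" using b S(2) by (simp add: in_Hom)
  finally have "p \<cdot> Ide C P = p \<cdot> (\<tau> \<cdot> \<sigma> j)" by simp
  moreover have "Ide C P \<in> Hom C P P" "\<tau> \<cdot> \<sigma> j \<in> Hom C P P" using S(9) \<tau> \<sigma>j by (simp_all add: in_Hom)
  ultimately obtain t where t: "t \<in> Hom C P K" "Ide C P = Add C (\<tau> \<cdot> \<sigma> j) (k \<cdot> t)"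
    using short_exact_lift_difference[OF assms(1)] by metis
  have "k \<cdot> Add C ((\<beta> \<cdot> \<iota> j) \<cdot> \<pi> j) (t \<cdot> k) = Add C (\<tau> \<cdot> \<sigma> j) (k \<cdot> t) \<cdot> k"
    using pre_comp[OF \<beta>(2), of "\<iota> j \<cdot> \<pi> j"] \<beta>(1) Dj(1,2) t(1) S(1) \<tau>(1) \<sigma>j by (simp add: in_Hom)
  also have "\<dots> = k \<cdot> Ide C K" using t(2)[symmetric] S(1) by (simp add: in_Hom)
  finally have I: "Add C ((\<beta> \<cdot> \<iota> j) \<cdot> \<pi> j) (t \<cdot> k) = Ide C K"
    by (rule mono_arr_cancel[OF S(4)]) (use \<beta> Dj t S in \<open>simp_all add: in_Hom\<close>)
  have "\<beta> \<cdot> \<iota> j \<in> Hom C (Y j) K" using \<beta> Dj by (simp add: in_Hom)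
  from stable_retractI[OF Dj(2) this P S(1) t(1) I[symmetric]] show ?thesis using that j(1) by blast
qed

end

section \<open>Repetition among stable syzygies, and embeddings into projectives\<close>

locale finite_torsionfree = abelian_enough_projectives +
  fixes n :: nat
  assumes krull_schmidt: "krull_schmidt C"
    and n: "n \<ge> 1"
    and finite_torsionfree: "finite ({M \<in> torsionfree C n. indecomposable C M} // iso_rel C)"
begin

text \<open>If \<open>Y\<close> were projective, so would be its stable retract \<open>K\<close>,
  and then \<open>X\<close> by \<open>projective_cokernel\<close>. Retractions in both directions
  are kept: one hands coresolutions from \<open>K\<close> to \<open>Y\<close>, and both serve to
  compare two kernels by way of their summands.\<close>

lemma stable_syzygy_indecomposable:
  assumes "local_ring (end_ring C X)" "\<not> projective C X" "proj_orthogonal C X"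
  shows "\<exists>Y k K P p. local_ring (end_ring C Y) \<and> \<not> projective C Y \<and> proj_orthogonal C Y \<and> indecomposable C Y \<and>
    short_exact C K k P p X \<and> left_proj_approx C k \<and> stable_retract C K Y \<and> stable_retract C Y K"
proof -
  from assms(3) obtain K k P p where K: "short_exact C K k P p X" "left_proj_approx C k" "proj_orthogonal C K"
    by (blast elim: proj_orthogonal.cases)
  obtain m Y \<iota> \<pi> where Y: "is_direct_sum C m Y K \<iota> \<pi>"
    "\<And>i. i < m \<Longrightarrow> indecomposable C (Y i) \<and> local_ring (end_ring C (Y i))"
    using krull_schmidt proj_orthogonal_Ob[OF K(3)] unfolding krull_schmidt_def by metis
  obtain j where j: "j < m" "stable_retract C K (Y j)"
    using stable_syzygy_summand[OF K(1,2) assms(1,2) Y(1)] .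
  have r: "stable_retract C (Y j) K" by (rule direct_summand_stable_retract[OF Y(1) j(1)])
  have "\<not> projective C (Y j)"
    using stable_retract_projective[OF j(2)] projective_cokernel[OF K(1,2)] assms(2) by blast
  with proj_orthogonal_stable_retract[OF K(3) r] Y(2)[OF j(1)] K j(2) r show ?thesis by blast
qed

lemma local_mono_approx:
  assumes "local_ring (end_ring C X)" "proj_orthogonal C X"
  obtains k P where "k \<in> Hom C X P" "mono_arr C k" "left_proj_approx C k"
proof (cases "projective C X")
  case True
  have "left_proj_approx C (Ide C X)"
    by (rule left_proj_approxI[OF _ True]) (use True in \<open>auto simp: in_Hom\<close>)
  moreover have "mono_arr C (Ide C X)" using True by (auto simp: mono_arr_def in_Hom)
  ultimately show ?thesis using that[of "Ide C X" X] Ide_Hom True by simp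
next
  case False
  define good where "good Y \<longleftrightarrow> local_ring (end_ring C Y) \<and> \<not> projective C Y \<and> proj_orthogonal C Y" for Y
  define step where "step X Y \<longleftrightarrow> (\<exists>k K P p. indecomposable C Y \<and> short_exact C K k P p X \<and>
    left_proj_approx C k \<and> stable_retract C K Y \<and> stable_retract C Y K)" for X Y
  have "\<exists>Y. good Y \<and> step X Y" if "good X" for X
    using stable_syzygy_indecomposable[of X] that unfolding good_def step_def by blast
  moreover have "good X" using assms False by (simp add: good_def)
  \<comment> \<open>The clause for \<open>i = 0\<close> in the invariant pins the first term of the
    chosen sequence to \<open>X\<close>.\<close>
  ultimately obtain F where F: "\<And>i. good (F i)" "F 0 = X" "\<And>i. step (F i) (F (Suc i))"
    using dependent_nat_choice[of "\<lambda>i Y. good Y \<and> (i = 0 \<longrightarrow> Y = X)" "\<lambda>_. step"] by (metis nat.distinct(1))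
  \<comment> \<open>The kernel \<open>K\<close> embeds into \<open>P\<close> with cokernel
    \<open>F i\<close>, which adds one step to the coresolution of \<open>F i\<close>;
    \<open>F (Suc i)\<close> inherits it from \<open>K\<close>.\<close>
  have cores: "approx_coresolvable C i (F i)" for i
  proof (induction i)
    case (Suc i)
    obtain k K P p where K: "short_exact C K k P p (F i)" "left_proj_approx C k" "stable_retract C (F (Suc i)) K"
      using F(3)[of i] unfolding step_def by blast
    then have "approx_coresolvable C (Suc i) K" using Suc by auto
    then show ?case using approx_coresolvable_stable_retract K(3) by blast
  qed simp
  have descend: "stable_retract C (F i) (F j)" if "stable_retract C (F (Suc i)) (F (Suc j))" for i j
  proof -
    obtain k K P p where K: "short_exact C K k P p (F i)" "left_proj_approx C k" "stable_retract C K (F (Suc i))"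
      using F(3)[of i] unfolding step_def by blast
    obtain l L R q where L: "short_exact C L l R q (F j)" "left_proj_approx C l" "stable_retract C (F (Suc j)) L"
      using F(3)[of j] unfolding step_def by blast
    show ?thesis
      by (rule stable_retract_cokernel[OF K(1) L(1) K(2) L(2)])
        (use K(3) L(3) that stable_retract_trans in blast)
  qed
  let ?S = "{M \<in> torsionfree C n. indecomposable C M}"
  \<comment> \<open>\<open>step\<close> records indecomposability of its target, so it is at hand
    from index 1 on; \<open>n \<ge> 1\<close> makes this cover every index used here.\<close>
  have FS: "F i \<in> ?S" if "i \<ge> n" for i
  proof -
    have "approx_coresolvable C n (F i)" using approx_coresolvable_antimono[OF cores that] .
    moreover have "i > 0" using that n by simp
    then obtain i' where "i = Suc i'" by (auto simp: gr0_conv_Suc)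
    ultimately show ?thesis using approx_coresolvable_torsionfree n F(3)[of i'] by (auto simp: step_def)
  qed
  have "(\<lambda>i. iso_rel C `` {F i}) ` {n..} \<subseteq> ?S // iso_rel C"
    using FS by (auto intro: quotientI)
  then have "finite ((\<lambda>i. iso_rel C `` {F i}) ` {n..})"
    using finite_torsionfree finite_subset by blast
  then have "\<not> inj_on (\<lambda>i. iso_rel C `` {F i}) {n..}"
    using finite_imageD infinite_Ici by blast
  then obtain i j where ij: "i < j" "iso_rel C `` {F i} = iso_rel C `` {F j}"
    unfolding inj_on_def by (metis nat_neq_iff)
  have "F j \<in> Ob C" using F(1)[of j] proj_orthogonal_Ob by (auto simp: good_def)
  then have "(F j, F j) \<in> iso_rel C"
    unfolding iso_rel_def using Ide_Hom by (auto intro!: bexI[of _ "Ide C (F j)"])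
  with ij(2) have "(F i, F j) \<in> iso_rel C" by blast
  then have "stable_retract C (F i) (F j)" by (rule iso_stable_retract)
  \<comment> \<open>Each use of \<open>descend\<close> lowers both indices by one and keeps their
    difference. As \<open>j - i\<close> is positive, \<open>F (j - i)\<close> has a coresolution
    with at least one step.\<close>
  then have "stable_retract C (F 0) (F (j - i))" using ij(1)
  proof (induction i arbitrary: j)
    case (Suc i)
    then obtain j' where "j = Suc j'" by (cases j) auto
    with Suc descend show ?case by auto
  qed simp
  moreover have "approx_coresolvable C (Suc 0) (F (j - i))"
    by (rule approx_coresolvable_antimono[OF cores]) (use ij(1) in simp)
  ultimately have "approx_coresolvable C (Suc 0) X"
    using approx_coresolvable_stable_retract F(2) by metis
  then obtain k P p Y where "short_exact C X k P p Y" "left_proj_approx C k" by auto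
  then show ?thesis using that short_exactD(1,4) by blast
qed

lemma mono_approx:
  assumes "proj_orthogonal C X"
  obtains k P p Y where "short_exact C X k P p Y" "left_proj_approx C k" "proj_orthogonal C Y"
proof -
  have X: "X \<in> Ob C" by (rule proj_orthogonal_Ob[OF assms])
  obtain m Y \<iota> \<pi> where Y: "is_direct_sum C m Y X \<iota> \<pi>" "\<And>i. i < m \<Longrightarrow> local_ring (end_ring C (Y i))"
    using krull_schmidt X unfolding krull_schmidt_def by metis
  note D = direct_sumD[OF Y(1)]
  \<comment> \<open>The approximations of the summands are collected by repeated pairing.
    \<open>adapted P f i\<close> says that \<open>f\<close> detects the \<open>i\<close>-th
    component of a map into \<open>X\<close> and extends maps out of the \<open>i\<close>-th
    summand. Both survive when \<open>f\<close> is replaced by some \<open>h\<close> with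
    \<open>p \<cdot> h = f\<close>; if all \<open>i\<close> are adapted, then \<open>f\<close> is a
    mono left approximation.\<close>
  define adapted where "adapted P f i \<longleftrightarrow>
    (\<forall>Z. \<forall>x \<in> Hom C Z X. f \<cdot> x = Zero C Z P \<longrightarrow> \<pi> i \<cdot> x = Zero C Z (Y i)) \<and>
    (\<forall>Q. projective C Q \<longrightarrow> (\<forall>g \<in> Hom C (Y i) Q. \<exists>h \<in> Hom C P Q. h \<cdot> f = g \<cdot> \<pi> i))" for P f i
  have "\<exists>P f. projective C P \<and> f \<in> Hom C X P \<and> (\<forall>i<l. adapted P f i)" if "l \<le> m" for l
    using that
  proof (induction l)
    case 0
    obtain P where P: "projective C P" using enough X unfolding enough_projectives_def by blast
    then show ?case using X by (intro exI[of _ P] exI[of _ "Zero C X P"]) (auto simp: in_Hom)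
  next
    case (Suc l)
    then obtain P f where P: "projective C P" "f \<in> Hom C X P" "\<And>i. i < l \<Longrightarrow> adapted P f i"
      by auto
    have l: "l < m" using Suc by simp
    note Dl = D(2,3,4)[OF l]
    obtain k P' where k: "k \<in> Hom C (Y l) P'" "mono_arr C k" "left_proj_approx C k"
      using local_mono_approx[OF Y(2)[OF l]
          proj_orthogonal_stable_retract[OF assms direct_summand_stable_retract[OF Y(1) l]]] .
    have k\<pi>: "k \<cdot> \<pi> l \<in> Hom C X P'" using k Dl by (simp add: in_Hom)
    obtain R h p q where R: "projective C R" "h \<in> Hom C X R" "p \<in> Hom C R P" "q \<in> Hom C R P'"
      "p \<cdot> h = f" "q \<cdot> h = k \<cdot> \<pi> l"
      using ex_projective_pairing[OF P(1) left_proj_approx_projective[OF k(3,1)] P(2) k\<pi>] .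
    have 1: "f \<cdot> x = Zero C Z P" "(k \<cdot> \<pi> l) \<cdot> x = Zero C Z P'" if x: "x \<in> Hom C Z X" "h \<cdot> x = Zero C Z R" for Z x
    proof -
      have Z: "Z \<in> Ob C" using x by (auto simp: in_Hom)
      have "f \<cdot> x = p \<cdot> (h \<cdot> x)" "(k \<cdot> \<pi> l) \<cdot> x = q \<cdot> (h \<cdot> x)"
        using pre_comp[OF R(5), of x] pre_comp[OF R(6), of x] x(1) R(2-4) by (simp_all add: in_Hom)
      then show "f \<cdot> x = Zero C Z P" "(k \<cdot> \<pi> l) \<cdot> x = Zero C Z P'"
        using Z R(3,4) x(2) by (simp_all add: in_Hom)
    qed
    have "adapted R h i" if "i < Suc l" for i
    proof (cases "i = l")
      case False
      then have i: "adapted P f i" using P(3) that by simp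
      show ?thesis
        unfolding adapted_def
      proof (intro conjI allI ballI impI)
        fix Q g assume "projective C Q" "g \<in> Hom C (Y i) Q"
        then obtain h' where h': "h' \<in> Hom C P Q" "h' \<cdot> f = g \<cdot> \<pi> i" using i unfolding adapted_def by blast
        then have "(h' \<cdot> p) \<cdot> h = g \<cdot> \<pi> i" using R(2,3,5) by (simp add: in_Hom)
        then show "\<exists>h'\<in>Hom C R Q. h' \<cdot> h = g \<cdot> \<pi> i"
          using h'(1) R(3) by (intro bexI[of _ "h' \<cdot> p"]) (simp_all add: in_Hom)
      qed (use 1(1) i in \<open>auto simp: adapted_def\<close>)
    next
      case True
      show ?thesis
        unfolding adapted_def True
      proof (intro conjI allI ballI impI)
        fix Q g assume Q: "projective C Q" and g: "g \<in> Hom C (Y l) Q"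
        obtain h' where h': "h' \<in> Hom C P' Q" "h' \<cdot> k = g" using left_proj_approx_extend[OF k(3,1) Q g] .
        then have "(h' \<cdot> q) \<cdot> h = g \<cdot> \<pi> l"
          using R(2,4,6) k(1) Dl(2) pre_comp[OF h'(2), of "\<pi> l"] by (simp add: in_Hom)
        then show "\<exists>h'\<in>Hom C R Q. h' \<cdot> h = g \<cdot> \<pi> l"
          using h'(1) R(4) by (intro bexI[of _ "h' \<cdot> q"]) (simp_all add: in_Hom)
      next
        fix Z x assume x: "x \<in> Hom C Z X" "h \<cdot> x = Zero C Z R"
        then have "k \<cdot> (\<pi> l \<cdot> x) = Zero C Z P'" using 1(2)[OF x] k(1) Dl(2) by (simp add: in_Hom)
        then show "\<pi> l \<cdot> x = Zero C Z (Y l)"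
          by (rule mono_arr_zero[OF k(2,1), rotated]) (use x Dl in \<open>simp add: in_Hom\<close>)
      qed
    qed
    with R show ?case by blast
  qed
  then obtain P f where P: "projective C P" "f \<in> Hom C X P" "\<And>i. i < m \<Longrightarrow> adapted P f i" by blast
  have "mono_arr C f"
  proof (rule mono_arrI[OF P(2)])
    fix Z x assume x: "x \<in> Hom C Z X" "f \<cdot> x = Zero C Z P"
    then have Z: "Z \<in> Ob C" by (auto simp: in_Hom)
    have 0: "\<pi> i \<cdot> x = Zero C Z (Y i)" if "i < m" for i using P(3)[OF that] x by (auto simp: adapted_def)
    have "x = finprod (hom_group C X X) (\<lambda>i. \<iota> i \<cdot> \<pi> i) {..<m} \<cdot> x" using D(5) x by (simp add: in_Hom)
    also have "\<dots> = finprod (hom_group C Z X) (\<lambda>i. (\<iota> i \<cdot> \<pi> i) \<cdot> x) {..<m}"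
      by (rule finprod_Comp) (use D(1-3) x in \<open>auto simp: in_Hom\<close>)
    also have "\<dots> = finprod (hom_group C Z X) (\<lambda>i. Zero C Z X) {..<m}"
    proof (rule finprod_hom_group_cong)
      fix i assume "i \<in> {..<m}"
      then have i: "i < m" by simp
      show "(\<iota> i \<cdot> \<pi> i) \<cdot> x = Zero C Z X"
        using D(2,3)[OF i] 0[OF i] x(1) Z X by (simp add: in_Hom)
    qed (use Z X in \<open>simp_all add: in_Hom\<close>)
    also have "\<dots> = Zero C Z X"
    proof -
      interpret H: comm_group "hom_group C Z X" by (rule hom_group[OF Z X])
      show ?thesis using H.finprod_one by simp
    qed
    finally show "x = Zero C Z X" .
  qed
  moreover have "left_proj_approx C f"
  proof (rule left_proj_approxI[OF P(2,1)])
    fix Q g assume Q: "projective C Q" and g: "g \<in> Hom C X Q"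
    have "\<exists>h. h \<in> Hom C P Q \<and> h \<cdot> f = (g \<cdot> \<iota> i) \<cdot> \<pi> i" if "i < m" for i
    proof -
      have "g \<cdot> \<iota> i \<in> Hom C (Y i) Q" using g D(2)[OF that] by (simp add: in_Hom)
      then show ?thesis using P(3)[OF that] Q unfolding adapted_def by blast
    qed
    then obtain h where h: "\<And>i. i < m \<Longrightarrow> h i \<in> Hom C P Q" "\<And>i. i < m \<Longrightarrow> h i \<cdot> f = (g \<cdot> \<iota> i) \<cdot> \<pi> i" by metis
    have PQ: "P \<in> Ob C" "Q \<in> Ob C" using P(1) Q by auto
    have "finprod (hom_group C P Q) h {..<m} \<cdot> f = finprod (hom_group C X Q) (\<lambda>i. h i \<cdot> f) {..<m}"
      by (rule finprod_Comp) (use h P PQ in auto)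
    also have "\<dots> = finprod (hom_group C X Q) (\<lambda>i. g \<cdot> (\<iota> i \<cdot> \<pi> i)) {..<m}"
      by (rule finprod_hom_group_cong) (use h(2) g D(2,3) X PQ in \<open>auto simp: in_Hom\<close>)
    also have "\<dots> = g \<cdot> finprod (hom_group C X X) (\<lambda>i. \<iota> i \<cdot> \<pi> i) {..<m}"
      by (rule Comp_finprod[symmetric]) (use g D(2,3) X in \<open>auto simp: in_Hom\<close>)
    also have "\<dots> = g" using D(5) g by (simp add: in_Hom)
    finally show "\<exists>h\<in>Hom C P Q. h \<cdot> f = g"
      using finprod_hom_group_closed[of "{..<m}" h P Q] h(1) PQ by auto
  qed
  moreover from \<open>mono_arr C f\<close> obtain p Z where "short_exact C X f P p Z"
    by (rule ex_mono_short_exact[OF _ P(2)])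
  \<comment> \<open>Read from its right end, the new sequence is the first step of a resolution of
    its cokernel with the orthogonal object \<open>X\<close> as syzygy, so the cokernel is
    orthogonal at once.\<close>
  ultimately show ?thesis using that proj_orthogonalI[OF _ _ assms] by metis
qed

end

section \<open>Totally acyclic complexes\<close>

context abelian_category
begin

lemma exact_at_Comp:
  assumes "exact_at C f g" "f \<in> Hom C X Y" "g \<in> Hom C Y Z"
  shows "g \<cdot> f = Zero C X Z"
proof -
  obtain I q m where q: "q \<in> Hom C X I" "m \<in> Hom C I Y" "epi_arr C q" "mono_arr C m" "f = m \<cdot> q"
    using ex_factorization[OF assms(2)] .
  have "is_kernel C g m" using exact_at_iff[OF q(3,1,4,2) assms(3)] assms(1) q(5) by simp
  from is_kernelD(2)[OF this assms(3)] have "g \<cdot> m = Zero C I Z" using q(2) by (simp add: in_Hom)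
  from pre_comp[OF this, of q] show ?thesis using q assms(3) by (auto simp: in_Hom)
qed

lemma hom_kernel_iff:
  "f \<in> kernel (hom_group C X Q) (hom_group C Y Q) (\<lambda>f. f \<cdot> g) \<longleftrightarrow> f \<in> Hom C X Q \<and> f \<cdot> g = Zero C Y Q"
  by (auto simp: kernel_def)

end

context abelian_enough_projectives
begin

lemma is_kernel_stable_retract:
  assumes "is_kernel C f k" "is_kernel C f l" "f \<in> Hom C X Y"
  shows "stable_retract C (Dom C k) (Dom C l)"
proof -
  note k = is_kernelD[OF assms(1,3)] and l = is_kernelD[OF assms(2,3)]
  obtain u where u: "u \<in> Hom C (Dom C k) (Dom C l)" "l \<cdot> u = k" using is_kernel_lift[OF assms(2,3) k(1,2)] .
  obtain v where v: "v \<in> Hom C (Dom C l) (Dom C k)" "k \<cdot> v = l" using is_kernel_lift[OF assms(1,3) l(1,2)] .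
  have "v \<cdot> u = Ide C (Dom C k)"
    by (rule mono_arr_cancel[OF k(3)]) (use u v k(1) l(1) pre_comp[OF v(2), of u] in \<open>simp_all add: in_Hom\<close>)
  then show ?thesis by (rule retract_stable_retract[OF u(1) v(1)])
qed

text \<open>Coinduction over the images of all differentials, moving left: the image of
  \<open>d (i - 1)\<close> is the kernel of the epi part of \<open>d i\<close>, and acyclicity under
  Hom into projectives makes its inclusion an approximation.\<close>

lemma gorenstein_projective_proj_orthogonal:
  assumes "X \<in> gorenstein_projectives C"
  shows "proj_orthogonal C X"
proof -
  obtain P d k where P: "totally_acyclic C P d" "is_kernel C (d 0) k" "(X, Dom C k) \<in> iso_rel C"
    using assms by (auto simp: gorenstein_projectives_def)
  have d: "projective C (P i)" "d i \<in> Hom C (P i) (P (i + 1))" for i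
    using P(1) by (auto simp: totally_acyclic_def)
  have ex: "exact_at C (d i) (d (i + 1))" for i
    using P(1) by (auto simp: totally_acyclic_def)
  have ext: "\<exists>h \<in> Hom C (P (i + 2)) Q. h \<cdot> d (i + 1) = f"
    if "projective C Q" "f \<in> Hom C (P (i + 1)) Q" "f \<cdot> d i = Zero C (P i) Q" for i Q f
  proof -
    have "(\<lambda>f. f \<cdot> d (i + 1)) ` Hom C (P (i + 2)) Q =
        kernel (hom_group C (P (i + 1)) Q) (hom_group C (P i) Q) (\<lambda>f. f \<cdot> d i)"
      using P(1) that(1) unfolding totally_acyclic_def by blast
    moreover have "f \<in> kernel (hom_group C (P (i + 1)) Q) (hom_group C (P i) Q) (\<lambda>f. f \<cdot> d i)"
      using that by (simp add: hom_kernel_iff)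
    ultimately have "f \<in> (\<lambda>f. f \<cdot> d (i + 1)) ` Hom C (P (i + 2)) Q" by simp
    then show ?thesis by auto
  qed
  have po: "proj_orthogonal C Z" if "q \<in> Hom C (P i) Z" "m \<in> Hom C Z (P (i + 1))" "epi_arr C q"
    "mono_arr C m" "d i = m \<cdot> q" for i q m Z
  proof -
    have "\<exists>i q m. q \<in> Hom C (P i) Z \<and> m \<in> Hom C Z (P (i + 1)) \<and> epi_arr C q \<and> mono_arr C m \<and> d i = m \<cdot> q"
      using that by blast
    then show ?thesis
    proof (coinduction arbitrary: Z rule: proj_orthogonal.coinduct)
      case (proj_orthogonal Z)
      then obtain i q m where q: "q \<in> Hom C (P i) Z" "m \<in> Hom C Z (P (i + 1))" "epi_arr C q"
        "mono_arr C m" "d i = m \<cdot> q" by blast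
      \<comment> \<open>This shift matches \<open>ext\<close>, which extends a cocycle on
        \<open>P (j + 1)\<close> along \<open>d (j + 1)\<close>, the differential into
        \<open>P i\<close>.\<close>
      define j where "j = i - 2"
      have ij: "i = j + 2" by (simp add: j_def)
      obtain I q' l where l: "q' \<in> Hom C (P (j + 1)) I" "l \<in> Hom C I (P (j + 1 + 1))" "epi_arr C q'" "mono_arr C l"
        "d (j + 1) = l \<cdot> q'" using ex_factorization[OF d(2)] .
      have jj: "j + 1 + 1 = i" by (simp add: ij)
      have li: "l \<in> Hom C I (P i)" using l(2) by (simp add: jj)
      have "exact_at C (l \<cdot> q') (d i)" using ex[of "j + 1"] l(5) by (simp add: jj)
      then have "is_kernel C (m \<cdot> q) l" using exact_at_iff[OF l(3,1,4) li d(2)] q(5) by simp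
      then have "is_kernel C q l" using is_kernel_mono_Comp[OF q(4,2,1)] by simp
      then have S: "short_exact C I l (P i) q Z"
        using epi_short_exact[OF q(3,1)] l(2) by (auto simp: in_Hom)
      have "left_proj_approx C l"
      proof (rule left_proj_approxI[OF li d(1)])
        fix Q g assume Q: "projective C Q" and g: "g \<in> Hom C I Q"
        \<comment> \<open>A map \<open>g\<close> on the image gives the cocycle
          \<open>g \<cdot> q'\<close>. The extension \<open>h\<close> found for it restricts to
          \<open>g\<close> because \<open>q'\<close> is epi.\<close>
        have "l \<cdot> (q' \<cdot> d j) = d (j + 1) \<cdot> d j" using l d(2)[of j] by (simp add: in_Hom)
        also have "\<dots> = Zero C (P j) (P i)"
          using exact_at_Comp[OF ex d(2) d(2), of j] unfolding jj .
        finally have "q' \<cdot> d j = Zero C (P j) I"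
          by (rule mono_arr_zero[OF l(4) li, rotated]) (use l d(2)[of j] in \<open>simp add: in_Hom\<close>)
        then have "(g \<cdot> q') \<cdot> d j = Zero C (P j) Q"
          using g l(1) d(2)[of j] projective_Ob[OF d(1)[of j]] by (simp add: in_Hom)
        moreover have "g \<cdot> q' \<in> Hom C (P (j + 1)) Q" using g l(1) by (simp add: in_Hom)
        ultimately obtain h where h: "h \<in> Hom C (P (j + 2)) Q" "h \<cdot> d (j + 1) = g \<cdot> q'"
          using ext[OF Q] by blast
        have hi: "h \<in> Hom C (P i) Q" using h(1) by (simp add: ij)
        have "h \<cdot> l = g"
          by (rule epi_arr_cancel[OF l(3)]) (use h(2) hi li l(1) g l(5) in \<open>simp_all add: in_Hom\<close>)
        with hi show "\<exists>h\<in>Hom C (P i) Q. h \<cdot> l = g" by blast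
      qed
      with S l show ?case by blast
    qed
  qed
  \<comment> \<open>By exactness the kernel of \<open>d 0\<close> is the image of
    \<open>d (-1)\<close>, to which \<open>po\<close> applies.\<close>
  obtain I q m where m: "q \<in> Hom C (P (-1)) I" "m \<in> Hom C I (P (-1 + 1))" "epi_arr C q" "mono_arr C m"
    "d (-1) = m \<cdot> q" using ex_factorization[OF d(2)] .
  have "is_kernel C (d 0) m"
    using exact_at_iff[OF m(3,1,4,2) d(2)] ex[of "-1"] m(5) by simp
  then have "stable_retract C (Dom C k) I"
    using is_kernel_stable_retract[OF P(2) _ d(2)] m(2) by (auto simp: in_Hom)
  then have "stable_retract C X I" using stable_retract_trans iso_stable_retract[OF P(3)] by blast
  then show ?thesis using proj_orthogonal_stable_retract po[OF m] by blast
qed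

end

context finite_torsionfree
begin

lemma proj_orthogonal_gorenstein_projective:
  assumes "proj_orthogonal C X"
  shows "X \<in> gorenstein_projectives C"
proof -
  define R where "R A B \<longleftrightarrow> (\<exists>k P p. short_exact C A k P p B \<and> left_proj_approx C k)" for A B
  have "\<exists>B. proj_orthogonal C B \<and> R A B" if A: "proj_orthogonal C A" for A
  proof -
    obtain k P p B where "short_exact C A k P p B" "left_proj_approx C k" "proj_orthogonal C B"
      using mono_approx[OF A] .
    then show ?thesis unfolding R_def by blast
  qed
  then obtain U where U: "\<And>A. proj_orthogonal C A \<Longrightarrow> proj_orthogonal C (U A) \<and> R A (U A)" by metis
  have "\<exists>B. proj_orthogonal C B \<and> R B A" if "proj_orthogonal C A" for A
    using that unfolding R_def by (blast elim: proj_orthogonal.cases)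
  then obtain D where D: "\<And>A. proj_orthogonal C A \<Longrightarrow> proj_orthogonal C (D A) \<and> R (D A) A" by metis
  \<comment> \<open>\<open>Z i\<close> becomes the kernel of \<open>d i\<close>, so
    \<open>Z 0 = X\<close> is the zeroth cocycle. Nonnegative indices iterate cokernels of
    approximations, negative ones iterate syzygies.\<close>
  define Z where "Z i = (if i \<ge> 0 then (U ^^ nat i) X else (D ^^ nat (- i)) X)" for i :: int
  have Up: "proj_orthogonal C ((U ^^ j) X)" for j by (induction j) (use assms U in auto)
  have Dp: "proj_orthogonal C ((D ^^ j) X)" for j by (induction j) (use assms D in auto)
  have "R (Z i) (Z (i + 1))" for i
  proof (cases "i \<ge> 0")
    case True
    then have "nat (i + 1) = Suc (nat i)" by simp
    then show ?thesis using U[OF Up[of "nat i"]] True by (simp add: Z_def)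
  next
    case False
    then have *: "nat (- i) = Suc (nat (- (i + 1)))" by simp
    have "Z (i + 1) = (D ^^ nat (- (i + 1))) X" using False by (auto simp: Z_def)
    moreover have "Z i = D ((D ^^ nat (- (i + 1))) X)" using False * by (simp add: Z_def)
    ultimately show ?thesis using D[OF Dp[of "nat (- (i + 1))"]] by simp
  qed
  then obtain k P p where S: "\<And>i. short_exact C (Z i) (k i) (P i) (p i) (Z (i + 1))"
    "\<And>i. left_proj_approx C (k i)" unfolding R_def by metis
  note SD = short_exactD[OF S(1)]
  define d where "d i = k (i + 1) \<cdot> p i" for i
  have P: "projective C (P i)" for i using left_proj_approx_projective[OF S(2) SD(1)] .
  have d: "d i \<in> Hom C (P i) (P (i + 1))" for i using SD(1)[of "i + 1"] SD(2)[of i] by (simp add: d_def in_Hom)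
  have ker: "is_kernel C (d i) (k i)" for i
    using is_kernel_mono_Comp[OF SD(4)[of "i + 1"] SD(1) SD(2)] SD(6) by (simp add: d_def)
  have "exact_at C (d i) (d (i + 1))" for i
    using exact_at_iff[OF SD(5)[of i] SD(2) SD(4) SD(1) d] ker unfolding d_def[of i] by blast
  moreover have "(\<lambda>f. f \<cdot> d (i + 1)) ` Hom C (P (i + 2)) Q =
      kernel (hom_group C (P (i + 1)) Q) (hom_group C (P i) Q) (\<lambda>f. f \<cdot> d i)" if Q: "projective C Q" for Q i
  proof (intro equalityI subsetI)
    have ii: "i + 1 + 1 = i + 2" by simp
    have dd: "d (i + 1) \<cdot> d i = Zero C (P i) (P (i + 2))"
      using exact_at_Comp[OF calculation d d, of i] unfolding ii .
    have d1: "d (i + 1) \<in> Hom C (P (i + 1)) (P (i + 2))" using d[of "i + 1"] by (simp add: ii)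
    fix f assume "f \<in> (\<lambda>f. f \<cdot> d (i + 1)) ` Hom C (P (i + 2)) Q"
    then obtain h where h: "h \<in> Hom C (P (i + 2)) Q" "f = h \<cdot> d (i + 1)" by auto
    then show "f \<in> kernel (hom_group C (P (i + 1)) Q) (hom_group C (P i) Q) (\<lambda>f. f \<cdot> d i)"
      using d1 d[of i] dd projective_Ob[OF P[of i]] by (simp add: hom_kernel_iff in_Hom)
  next
    have ii: "i + 1 + 1 = i + 2" by simp
    fix f assume f: "f \<in> kernel (hom_group C (P (i + 1)) Q) (hom_group C (P i) Q) (\<lambda>f. f \<cdot> d i)"
    then have ft: "f \<in> Hom C (P (i + 1)) Q" and f0: "f \<cdot> (k (i + 1) \<cdot> p i) = Zero C (P i) Q"
      by (auto simp: hom_kernel_iff d_def)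
    \<comment> \<open>A cocycle vanishes on \<open>Z (i + 1)\<close>, the image of
      \<open>d i\<close>, hence descends to \<open>Z (i + 2)\<close> and extends from there along
      the approximation \<open>k (i + 2)\<close>.\<close>
    have "f \<cdot> k (i + 1) = Zero C (Z (i + 1)) Q"
      by (rule epi_arr_zero[OF SD(5)[of i] SD(2)[of i]])
        (use ft f0 SD(1)[of "i + 1"] SD(2)[of i] in \<open>simp_all add: in_Hom\<close>)
    from short_exact_colift[OF S(1) ft this]
    obtain g where g: "g \<in> Hom C (Z (i + 2)) Q" "g \<cdot> p (i + 1) = f" by (auto simp: ii)
    obtain h where h: "h \<in> Hom C (P (i + 2)) Q" "h \<cdot> k (i + 2) = g"
      using left_proj_approx_extend[OF S(2) SD(1) Q g(1)] .
    have "h \<cdot> d (i + 1) = (h \<cdot> k (i + 2)) \<cdot> p (i + 1)"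
      using h(1) SD(1)[of "i + 2"] SD(2)[of "i + 1"] by (simp add: d_def ii in_Hom)
    then have "h \<cdot> d (i + 1) = f" using g h by simp
    with h(1) show "f \<in> (\<lambda>f. f \<cdot> d (i + 1)) ` Hom C (P (i + 2)) Q" by blast
  qed
  ultimately have "totally_acyclic C P d" using P d by (simp add: totally_acyclic_def)
  moreover have "Dom C (k 0) = X" using SD(1)[of 0] by (simp add: in_Hom Z_def)
  moreover have "(X, X) \<in> iso_rel C"
    using Ide_Hom proj_orthogonal_Ob[OF assms] unfolding iso_rel_def
    by (auto intro!: bexI[of _ "Ide C X"])
  ultimately show ?thesis using ker[of 0] unfolding gorenstein_projectives_def by auto
qed

end

section \<open>Vanishing of Ext\<close>

text \<open>Turns vanishing of cohomology into an inclusion of cocycles \<open>Z\<close> in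
  coboundaries \<open>H\<close>. In a trivial quotient \<open>H\<close> is the only coset, and each
  \<open>z\<close> lies in its own coset since \<open>H\<close> contains the unit.\<close>

lemma (in comm_group) trivial_Mod_iff:
  assumes "subgroup Z G" "H \<subseteq> Z" "\<one> \<in> H"
  shows "trivial_group (G\<lparr>carrier := Z\<rparr> Mod H) \<longleftrightarrow> Z \<subseteq> H"
proof
  assume "trivial_group (G\<lparr>carrier := Z\<rparr> Mod H)"
  then have *: "rcosets\<^bsub>G\<lparr>carrier := Z\<rparr>\<^esub> H = {H}" by (simp add: trivial_group_def FactGroup_def)
  show "Z \<subseteq> H"
  proof
    fix z assume z: "z \<in> Z"
    then have "H #>\<^bsub>G\<lparr>carrier := Z\<rparr>\<^esub> z = H" using * by (auto simp: RCOSETS_def)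
    moreover have "z \<in> H #>\<^bsub>G\<lparr>carrier := Z\<rparr>\<^esub> z"
      using assms(3) subgroup.mem_carrier[OF assms(1) z] by (auto simp: r_coset_def intro!: bexI[of _ "\<one>"])
    ultimately show "z \<in> H" by simp
  qed
next
  assume "Z \<subseteq> H"
  with assms have H: "H = Z" by auto
  let ?K = "G\<lparr>carrier := Z\<rparr>"
  interpret K: comm_group ?K 
    by (rule group.group_comm_groupI[OF subgroup_imp_group[OF assms(1)]])
      (simp add: m_comm subgroup.mem_carrier[OF assms(1)])
  have Z: "subgroup Z ?K" using K.subgroup_self by simp
  have "rcosets\<^bsub>?K\<^esub> Z = {Z}"
    using K.coset_join2[OF _ Z] K.one_closed unfolding RCOSETS_def by fastforce
  then show "trivial_group (?K Mod H)"
    using normal.factorgroup_is_group[OF K.subgroup_imp_normal[OF Z]] unfolding H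
    by (simp add: trivial_group_def FactGroup_def)
qed

context abelian_category
begin

text \<open>\<open>Z (Suc i)\<close> is the image of \<open>d i\<close>, so \<open>Z\<close> lists
  the syzygies. The augmentation \<open>e\<close> plays the role of the epi part in degree 0 and is
  joined to the others by \<open>case_nat\<close>.\<close>

lemma proj_resolution_short_exact:
  assumes "proj_resolution C X (P, d, e)"
  obtains Z q m where "Z 0 = X" "q 0 = e" "\<And>i. short_exact C (Z (Suc i)) (m i) (P i) (q i) (Z i)"
    "\<And>i. projective C (P i)" "\<And>i. d i = m i \<cdot> q (Suc i)"
proof -
  have P: "projective C (P i)" "d i \<in> Hom C (P (Suc i)) (P i)" "exact_at C (d (Suc i)) (d i)" for i
    using assms by (auto simp: proj_resolution_def)
  have e: "e \<in> Hom C (P 0) X" "epi_arr C e" "exact_at C (d 0) e"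
    using assms by (auto simp: proj_resolution_def)
  have "\<exists>I q m. q \<in> Hom C (P (Suc i)) I \<and> m \<in> Hom C I (P i) \<and> epi_arr C q \<and> mono_arr C m \<and> d i = m \<cdot> q" for i
  proof -
    obtain I q m where "q \<in> Hom C (P (Suc i)) I" "m \<in> Hom C I (P i)" "epi_arr C q" "mono_arr C m" "d i = m \<cdot> q"
      using ex_factorization[OF P(2)] .
    then show ?thesis by blast
  qed
  then obtain I q m where m: "\<And>i. q i \<in> Hom C (P (Suc i)) (I i)" "\<And>i. m i \<in> Hom C (I i) (P i)"
    "\<And>i. epi_arr C (q i)" "\<And>i. mono_arr C (m i)" "\<And>i. d i = m i \<cdot> q i" by metis
  have domm: "Dom C (m i) = I i" for i using m(2)[of i] by (simp add: in_Hom)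
  have "is_kernel C e (m 0)" using exact_at_iff[OF m(3,1,4,2) e(1)] e(3) m(5) by simp
  then have 0: "short_exact C (I 0) (m 0) (P 0) e X" using epi_short_exact[OF e(2,1)] domm by metis
  have "is_kernel C (d i) (m (Suc i))" for i
    using exact_at_iff[OF m(3,1,4,2) P(2)[of i]] P(3)[of i] m(5) by simp
  then have "is_kernel C (q i) (m (Suc i))" for i
    using is_kernel_mono_Comp[OF m(4,2,1)] m(5) by metis
  then have "short_exact C (I (Suc i)) (m (Suc i)) (P (Suc i)) (q i) (I i)" for i
    using epi_short_exact[OF m(3,1)] domm by metis
  with 0 have "short_exact C (case_nat X I (Suc i)) (m i) (P i) (case_nat e q i) (case_nat X I i)" for i
    by (cases i) auto
  then show ?thesis using that[of "case_nat X I" "case_nat e q" m] P(1) m(5) by simp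
qed

text \<open>A cocycle in degree \<open>j + 1\<close> is a morphism out of the syzygy \<open>Z (j + 1)\<close>, and it is a
  coboundary iff that morphism extends along \<open>m j\<close>.\<close>

lemma trivial_cohomology_iff:
  assumes S: "\<And>i. short_exact C (Z (Suc i)) (m i) (P i) (q i) (Z i)" and d: "\<And>i. d i = m i \<cdot> q (Suc i)"
    and Q: "Q \<in> Ob C"
  shows "trivial_group ((hom_group C (P (Suc j)) Q)\<lparr>carrier := hom_cocycles C P d Q (Suc j)\<rparr> Mod
      hom_coboundaries C P d Q (Suc j)) \<longleftrightarrow>
    (\<forall>g \<in> Hom C (Z (Suc j)) Q. \<exists>h \<in> Hom C (P j) Q. h \<cdot> m j = g)"
proof -
  note SD = short_exactD[OF S]
  have dt: "d i \<in> Hom C (P (Suc i)) (P i)" for i using SD(1)[of i] SD(2)[of "Suc i"] by (simp add: d in_Hom)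
  have co: "hom_cocycles C P d Q (Suc j) = {f \<in> Hom C (P (Suc j)) Q. f \<cdot> d (Suc j) = Zero C (P (Suc (Suc j))) Q}"
    by (auto simp: hom_cocycles_def hom_kernel_iff)
  have cob: "hom_coboundaries C P d Q (Suc j) = (\<lambda>f. f \<cdot> d j) ` Hom C (P j) Q"
    by (simp add: hom_coboundaries_def)
  interpret G: comm_group "hom_group C (P (Suc j)) Q" by (rule hom_group[OF SD(9) Q])
  interpret G': comm_group "hom_group C (P (Suc (Suc j))) Q" by (rule hom_group[OF SD(9) Q])
  interpret h: group_hom "hom_group C (P (Suc j)) Q" "hom_group C (P (Suc (Suc j))) Q" "\<lambda>f. f \<cdot> d (Suc j)"
    by unfold_locales (use dt[of "Suc j"] in \<open>auto simp: hom_def in_Hom\<close>)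
  have sub: "subgroup (hom_cocycles C P d Q (Suc j)) (hom_group C (P (Suc j)) Q)"
    unfolding hom_cocycles_def by (rule h.subgroup_kernel)
  have "d j \<cdot> d (Suc j) = Zero C (P (Suc (Suc j))) (P j)"
    using pre_comp[OF SD(3)[of "Suc j"], of "q (Suc (Suc j))"] SD(1)[of j] SD(1,2)[of "Suc j"]
      SD(2)[of "Suc (Suc j)"] SD(8)[of j] SD(9)
    by (simp add: d in_Hom)
  then have "hom_coboundaries C P d Q (Suc j) \<subseteq> hom_cocycles C P d Q (Suc j)"
    using dt[of j] dt[of "Suc j"] SD(9) Q by (auto simp: co cob in_Hom)
  moreover have "Zero C (P (Suc j)) Q \<in> hom_coboundaries C P d Q (Suc j)"
    unfolding cob by (rule image_eqI[of _ _ "Zero C (P j) Q"]) (use dt[of j] SD(9) Q in \<open>simp_all add: in_Hom\<close>)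
  ultimately have "trivial_group ((hom_group C (P (Suc j)) Q)\<lparr>carrier := hom_cocycles C P d Q (Suc j)\<rparr> Mod
      hom_coboundaries C P d Q (Suc j)) \<longleftrightarrow> hom_cocycles C P d Q (Suc j) \<subseteq> hom_coboundaries C P d Q (Suc j)"
    using G.trivial_Mod_iff[OF sub] by simp
  also have "\<dots> \<longleftrightarrow> (\<forall>g \<in> Hom C (Z (Suc j)) Q. \<exists>h \<in> Hom C (P j) Q. h \<cdot> m j = g)"
  proof
    assume le: "hom_cocycles C P d Q (Suc j) \<subseteq> hom_coboundaries C P d Q (Suc j)"
    show "\<forall>g \<in> Hom C (Z (Suc j)) Q. \<exists>h \<in> Hom C (P j) Q. h \<cdot> m j = g"
    proof
      fix g assume g: "g \<in> Hom C (Z (Suc j)) Q"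
      have "q (Suc j) \<cdot> d (Suc j) = Zero C (P (Suc (Suc j))) (Z (Suc j))"
        using pre_comp[OF SD(3)[of "Suc j"], of "q (Suc (Suc j))"] SD(1,2)[of "Suc j"]
          SD(2)[of "Suc (Suc j)"] SD(10)
        by (simp add: d in_Hom)
      then have "g \<cdot> q (Suc j) \<in> hom_cocycles C P d Q (Suc j)"
        using g SD(2)[of "Suc j"] dt[of "Suc j"] SD(9) by (simp add: co in_Hom)
      then obtain h where h: "h \<in> Hom C (P j) Q" "h \<cdot> d j = g \<cdot> q (Suc j)" using le unfolding cob by force
      have "h \<cdot> m j = g"
        by (rule epi_arr_cancel[OF SD(5)[of "Suc j"]])
          (use h g SD(1)[of j] SD(2)[of "Suc j"] in \<open>simp_all add: d in_Hom\<close>)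
      with h show "\<exists>h \<in> Hom C (P j) Q. h \<cdot> m j = g" by blast
    qed
  next
    assume ext: "\<forall>g \<in> Hom C (Z (Suc j)) Q. \<exists>h \<in> Hom C (P j) Q. h \<cdot> m j = g"
    show "hom_cocycles C P d Q (Suc j) \<subseteq> hom_coboundaries C P d Q (Suc j)"
    proof
      fix f assume "f \<in> hom_cocycles C P d Q (Suc j)"
      then have f: "f \<in> Hom C (P (Suc j)) Q" "f \<cdot> d (Suc j) = Zero C (P (Suc (Suc j))) Q" by (auto simp: co)
      have "f \<cdot> m (Suc j) = Zero C (Z (Suc (Suc j))) Q"
        by (rule epi_arr_zero[OF SD(5)[of "Suc (Suc j)"] SD(2)])
          (use f SD(1)[of "Suc j"] SD(2)[of "Suc (Suc j)"] in \<open>simp_all add: d in_Hom\<close>)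
      then obtain g where g: "g \<in> Hom C (Z (Suc j)) Q" "g \<cdot> q (Suc j) = f"
        using short_exact_colift[OF S f(1)] by blast
      then obtain h where h: "h \<in> Hom C (P j) Q" "h \<cdot> m j = g" using ext by blast
      have "h \<cdot> d j = (h \<cdot> m j) \<cdot> q (Suc j)"
        using h(1) SD(1)[of j] SD(2)[of "Suc j"] by (simp add: d in_Hom)
      then have "f = h \<cdot> d j" using g h by simp
      with h(1) show "f \<in> hom_coboundaries C P d Q (Suc j)" unfolding cob by blast
    qed
  qed
  finally show ?thesis .
qed

end

context abelian_enough_projectives
begin

text \<open>\<open>Ext\<close> takes its resolution by \<open>SOME\<close>; existence guarantees
  that the chosen triple really is one.\<close>

lemma ex_proj_resolution:
  assumes "X \<in> Ob C"
  shows "\<exists>r. proj_resolution C X r"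
proof -
  define R where "R K Y \<longleftrightarrow> (\<exists>k P p. short_exact C K k P p Y \<and> projective C P)" for K Y
  have "\<exists>K. K \<in> Ob C \<and> R K Y" if Y: "Y \<in> Ob C" for Y
  proof -
    obtain K k P p where "short_exact C K k P p Y" "projective C P" using ex_presentation[OF Y] .
    then show ?thesis using short_exactD(8) unfolding R_def by blast
  qed
  then obtain Z where Z: "Z 0 = X" "\<And>i. R (Z (Suc i)) (Z i)"
    using dependent_nat_choice[of "\<lambda>i Y. Y \<in> Ob C \<and> (i = 0 \<longrightarrow> Y = X)" "\<lambda>_ Y K. R K Y"] assms
    by (metis nat.distinct(1))
  then obtain k P p where S: "\<And>i. short_exact C (Z (Suc i)) (k i) (P i) (p i) (Z i)" "\<And>i. projective C (P i)"
    unfolding R_def by metis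
  note SD = short_exactD[OF S(1)]
  define d where "d i = k i \<cdot> p (Suc i)" for i
  have d: "d i \<in> Hom C (P (Suc i)) (P i)" for i using SD(1)[of i] SD(2)[of "Suc i"] by (simp add: d_def in_Hom)
  have "exact_at C (d 0) (p 0)"
    using exact_at_iff[OF SD(5)[of "Suc 0"] SD(2) SD(4) SD(1) SD(2)] SD(6) by (simp add: d_def)
  moreover have "exact_at C (d (Suc i)) (d i)" for i
  proof -
    have "is_kernel C (d i) (k (Suc i))"
      using is_kernel_mono_Comp[OF SD(4,1)[of i] SD(2)[of "Suc i"]] SD(6)[of "Suc i"] by (simp add: d_def)
    then show ?thesis
      using exact_at_iff[OF SD(5)[of "Suc (Suc i)"] SD(2) SD(4) SD(1) d] unfolding d_def[of "Suc i"] by blast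
  qed
  ultimately have "proj_resolution C X (P, d, p 0)"
    using S(2) d SD(2,5)[of 0] Z(1) by (simp add: proj_resolution_def)
  then show ?thesis by blast
qed

text \<open>For the chosen resolution, vanishing of \<open>Ext\<close> in degree
  \<open>j + 1\<close> against all projectives says that \<open>m j\<close> is a left approximation.
  For all \<open>j\<close> together this gives \<open>proj_orthogonal\<close> by coinduction. The
  converse rests on \<open>proj_orthogonal_kernel\<close>, because the coinductive witness may come
  from another resolution.\<close>

lemma perp_projectives_iff: "X \<in> perp_projectives C \<longleftrightarrow> proj_orthogonal C X"
proof (cases "X \<in> Ob C")
  case True
  obtain P d e where r: "(SOME r. proj_resolution C X r) = (P, d, e)" by (metis prod_cases3)
  have "proj_resolution C X (P, d, e)"
    using someI_ex[OF ex_proj_resolution[OF True]] r by simp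
  then obtain Z q m where Z: "Z 0 = X" "\<And>i. short_exact C (Z (Suc i)) (m i) (P i) (q i) (Z i)"
    "\<And>i. projective C (P i)" "\<And>i. d i = m i \<cdot> q (Suc i)" by (rule proj_resolution_short_exact) blast
  note SD = short_exactD[OF Z(2)]
  have "X \<in> perp_projectives C \<longleftrightarrow> (\<forall>j Q. projective C Q \<longrightarrow> trivial_group (Ext C (Suc j) X Q))"
    using True unfolding perp_projectives_def by (auto simp: Suc_le_eq gr0_conv_Suc)
  also have "\<dots> \<longleftrightarrow> (\<forall>j Q. projective C Q \<longrightarrow> (\<forall>g \<in> Hom C (Z (Suc j)) Q. \<exists>h \<in> Hom C (P j) Q. h \<cdot> m j = g))"
  proof (intro iff_allI imp_cong refl)
    fix j Q assume "projective C Q"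
    then have "Q \<in> Ob C" by simp
    then show "trivial_group (Ext C (Suc j) X Q) \<longleftrightarrow> (\<forall>g \<in> Hom C (Z (Suc j)) Q. \<exists>h \<in> Hom C (P j) Q. h \<cdot> m j = g)"
      using trivial_cohomology_iff[where Z = Z and m = m and P = P and q = q and d = d, OF Z(2,4)] by (simp add: Ext_def r)
  qed
  also have "\<dots> \<longleftrightarrow> (\<forall>j. left_proj_approx C (m j))"
  proof (intro iff_allI)
    fix j
    have "m j \<in> Arr C" "Dom C (m j) = Z (Suc j)" "Cod C (m j) = P j" using SD(1)[of j] by (simp_all add: in_Hom)
    then show "(\<forall>Q. projective C Q \<longrightarrow> (\<forall>g \<in> Hom C (Z (Suc j)) Q. \<exists>h \<in> Hom C (P j) Q. h \<cdot> m j = g))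
      \<longleftrightarrow> left_proj_approx C (m j)" using Z(3) by (simp add: left_proj_approx_def)
  qed
  also have "\<dots> \<longleftrightarrow> proj_orthogonal C X"
  proof
    assume m: "\<forall>j. left_proj_approx C (m j)"
    have "\<exists>i. X = Z i" using Z(1) by metis
    then show "proj_orthogonal C X"
    proof (coinduction arbitrary: X rule: proj_orthogonal.coinduct)
      case (proj_orthogonal X)
      then show ?case using Z(2) m by blast
    qed
  next
    assume X: "proj_orthogonal C X"
    have "proj_orthogonal C (Z j)" for j
      by (induction j) (use X Z(1) proj_orthogonal_kernel(2)[OF _ Z(2,3)] in auto)
    then show "\<forall>j. left_proj_approx C (m j)" using proj_orthogonal_kernel(1)[OF _ Z(2,3)] by blast
  qed
  finally show ?thesis .
next
  case False
  then show ?thesis using proj_orthogonal_Ob by (auto simp: perp_projectives_def)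
qed

end

theorem corollary4p5:
  fixes C :: "('o, 'm) cat"
  assumes "abelian_category C"
    and "enough_projectives C"
    and "krull_schmidt C"
    and "\<exists>n\<ge>1. finite ({M \<in> torsionfree C n. indecomposable C M} // iso_rel C)"
  shows "weakly_gorenstein C"
proof -
  obtain n where n: "n \<ge> 1" "finite ({M \<in> torsionfree C n. indecomposable C M} // iso_rel C)"
    using assms(4) by blast
  interpret abelian_category C by (rule assms(1))
  interpret finite_torsionfree C n by unfold_locales (use assms n in auto)
  show ?thesis
    unfolding weakly_gorenstein_def
    using gorenstein_projective_proj_orthogonal proj_orthogonal_gorenstein_projective perp_projectives_iff
    by blast
qed

end
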